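(* Let $t$ be a positive odd integer and let $\tilde\rho_1,\tilde\rho_2$ be two functions defined on $\mathbb{Z}\times\{-1,1\}$. Let $f_t,g_t$ be the formal power series $$f_t(q):=\sum_{\nu\in\mathcal{P}}q^{|\nu|}\prod_{h\in\mathcal{H}(\nu)}\tilde\rho_1(th,1)\tilde\rho_1(th,-1),$$ $$g_t(q):=\sum_{\nu\in\mathcal{P}}q^{|\nu|}\prod_{h\in\mathcal{H}(\nu)}\tilde\rho_1(th,1)\tilde\rho_1(th,-1)\sum_{h\in\mathcal{H}(\nu)}\left(\tilde\rho_2(th,1)+\tilde\rho_2(th,-1)\right).$$ Then $$\sum_{\lambda\in\mathrm{BG}^t}q^{|\lambda|}x^{|\mathcal{H}_t(\lambda)|}\prod_{u\in\lambda,\, h_u\in\mathcal{H}_t(\lambda)}\tilde\rho_1(h_u,\varepsilon_{u})\sum_{u\in\lambda,\, h_u\in\mathcal{H}_t(\lambda)}\tilde\rho_2(h_u,\varepsilon_{u})= \frac{t-1}{2}\left(f_t(x^2q^{2t})\right)^{(t-3)/2}g_t(x^2q^{2t})\frac{\left(q^{2t};q^{2t}\right)^{(t-1)/2}_{\infty}\left(-q;q^2\right)_{\infty}}{\left(-q^t;q^{2t}\right)_{\infty}}.$$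
   Context: A partition is a finite nonincreasing sequence $\lambda=(\lambda_1,\dots,\lambda_\ell)$ of positive integers (the empty partition is allowed; set $\lambda_i=0$ for $i>\ell$), $|\lambda|$ is the sum of its parts, and $\mathcal{P}$ is the set of all partitions. A partition is identified with its Ferrers diagram, the set of boxes $u=(i,j)$ (row $i$, column $j$) with $1\le j\le\lambda_i$. The conjugate $\lambda'$ is given by $\lambda'_j=\#\{i:\lambda_i\ge j\}$; $\mathcal{SC}$ is the set of self-conjugate partitions ($\lambda=\lambda'$). The hook-length of $u=(i,j)$ is $h_u=\lambda_i-j+\lambda'_j-i+1$; $\mathcal{H}(\lambda)$ is the multiset of all hook-lengths of $\lambda$, and $\mathcal{H}_t(\lambda)$ is the sub-multiset of those divisible by $t$ (cardinality, products and sums are taken with multiplicity; empty products are $1$, empty sums are $0$). The conditions "$u\in\lambda$, $h_u\in\mathcal{H}_t(\lambda)$" mean that $u$ ranges over the boxes of $\lambda$ with $t\mid h_u$. The sign $\varepsilon_u$ of a box $u=(i,j)$ is $-1$ if $u$ lies strictly below the main diagonal ($i>j$) and $1$ otherwise. Also $(a;q)_\infty=\prod_{j\ge0}(1-aq^j)$. Word and $t$-quotient: walk along the border of the Ferrers diagram of $\lambda$ from South-West to North-East (including the two infinite half-axes), writing $0$ for a vertical step and $1$ for a horizontal step. This gives a word $s(\lambda)=(c_i)_{i\in\mathbb{Z}}$, with the indexing fixed by $\#\{i\le-1: c_i=1\}=\#\{i\ge0:c_i=0\}$. (Equivalently, $c_m=0$ iff $m=\lambda_i-i$ for some $i\ge1$.)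 For $k\in\{0,\dots,t-1\}$, $\nu^{(k)}$ is the partition whose word is, up to a shift of the indices, $(c_{ti+k})_{i\in\mathbb{Z}}$; the tuple $(\nu^{(0)},\dots,\nu^{(t-1)})$ is the $t$-quotient of $\lambda$. For $t$ odd, $\mathrm{BG}^t$ is the set of $\lambda\in\mathcal{SC}$ whose $t$-quotient satisfies $\nu^{((t-1)/2)}=\emptyset$. The functions $\tilde\rho_1,\tilde\rho_2$ take complex values. The identity is one of formal power series in $q$ with coefficients polynomial in $x$. *)

theory Defs
  imports "HOL-Analysis.Analysis" "HOL-Computational_Algebra.Polynomial"
    "HOL-Computational_Algebra.Formal_Power_Series"
begin

section \<open>Partitions, hooks and signs\<close>

definition is_partition :: "nat list \<Rightarrow> bool" where
  "is_partition la \<longleftrightarrow> sorted_wrt (\<ge>) la \<and> 0 \<notin> set la"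

definition partitions :: "nat list set" where
  "partitions = {la. is_partition la}"

text \<open>Parts, rows and columns are numbered from 1.\<close>

definition part_at :: "nat list \<Rightarrow> nat \<Rightarrow> nat" where
  "part_at la i = (if 1 \<le> i \<and> i \<le> length la then la ! (i - 1) else 0)"

definition conjugate :: "nat list \<Rightarrow> nat list" where
  "conjugate la = map (\<lambda>j. card {i. 1 \<le> i \<and> j \<le> part_at la i}) [1..<Suc (part_at la 1)]"

definition self_conjugates :: "nat list set" where
  "self_conjugates = {la \<in> partitions. conjugate la = la}"

definition boxes :: "nat list \<Rightarrow> (nat \<times> nat) set" where
  "boxes la = {(i, j). 1 \<le> i \<and> 1 \<le> j \<and> j \<le> part_at la i}"

definition hook :: "nat list \<Rightarrow> nat \<times> nat \<Rightarrow> int" where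
  "hook la = (\<lambda>(i, j). int (part_at la i) - int j + int (part_at (conjugate la) j) - int i + 1)"

definition hooks :: "nat list \<Rightarrow> int multiset" where
  "hooks la = image_mset (hook la) (mset_set (boxes la))"

definition hooks_t :: "nat \<Rightarrow> nat list \<Rightarrow> int multiset" where
  "hooks_t t la = filter_mset (\<lambda>h. int t dvd h) (hooks la)"

definition box_sign :: "nat \<times> nat \<Rightarrow> int" where
  "box_sign = (\<lambda>(i, j). if i > j then - 1 else 1)"


section \<open>The border word and the quotient\<close>

text \<open>
  The point \<^term>\<open>(r, k)\<close> is the lattice point at depth \<^term>\<open>r\<close> and at horizontal distance
  \<^term>\<open>k\<close> from the top left corner of the diagram, i.e.\ the south-east corner of the box
  \<^term>\<open>(r, k)\<close>. The border includes the two half-axes below and to the right of the diagram.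
\<close>

definition border :: "nat list \<Rightarrow> (nat \<times> nat) set" where
  "border la = {(r, k). (r + 1, k + 1) \<notin> boxes la \<and> (r = 0 \<or> k = 0 \<or> (r, k) \<in> boxes la)}"

text \<open>The words read along the border from South-West to North-East, with arbitrary indexing.\<close>

definition is_border_word :: "nat list \<Rightarrow> (int \<Rightarrow> nat) \<Rightarrow> bool" where
  "is_border_word la c \<longleftrightarrow> (\<exists>P. \<forall>m. P m \<in> border la \<and>
     (c m = 0 \<and> fst (P m) = fst (P (m + 1)) + 1 \<and> snd (P (m + 1)) = snd (P m) \<or>
      c m = 1 \<and> fst (P (m + 1)) = fst (P m) \<and> snd (P (m + 1)) = snd (P m) + 1))"

definition word :: "nat list \<Rightarrow> int \<Rightarrow> nat" where
  "word la = (THE c. is_border_word la c \<and>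
     card {i. i \<le> - 1 \<and> c i = 1} = card {i. i \<ge> 0 \<and> c i = 0})"

definition t_quotient :: "nat \<Rightarrow> nat list \<Rightarrow> nat \<Rightarrow> nat list" where
  "t_quotient t la k = (THE nu. nu \<in> partitions \<and>
     (\<exists>s. \<forall>i. word nu (i + s) = word la (int t * i + int k)))"

definition BG :: "nat \<Rightarrow> nat list set" where
  "BG t = {la \<in> self_conjugates. t_quotient t la ((t - 1) div 2) = []}"


section \<open>Formal power series\<close>

text \<open>The series \<open>\<Sum>\<^sub>\<lambda> q\<^bsup>|\<lambda>|\<^esup> w(\<lambda>)\<close> over \<open>\<lambda> \<in> A\<close>; every coefficient is a finite sum.\<close>

definition partition_series :: "nat list set \<Rightarrow> (nat list \<Rightarrow> 'a) \<Rightarrow> 'a::comm_ring_1 fps" where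
  "partition_series A w = Abs_fps (\<lambda>n. \<Sum>la\<in>{la \<in> A. sum_list la = n}. w la)"

text \<open>
  The functions \<open>\<rho>\<^sub>1, \<rho>\<^sub>2\<close> are total on \<^typ>\<open>int\<close> in their second argument, but are only ever
  used at \<open>1\<close> and \<open>-1\<close>.
\<close>

definition f_series :: "nat \<Rightarrow> (int \<Rightarrow> int \<Rightarrow> complex) \<Rightarrow> complex fps" where
  "f_series t rho1 = partition_series partitions
     (\<lambda>nu. \<Prod>h\<in>#hooks nu. rho1 (int t * h) 1 * rho1 (int t * h) (- 1))"

definition g_series ::
  "nat \<Rightarrow> (int \<Rightarrow> int \<Rightarrow> complex) \<Rightarrow> (int \<Rightarrow> int \<Rightarrow> complex) \<Rightarrow> complex fps" where
  "g_series t rho1 rho2 = partition_series partitions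
     (\<lambda>nu. (\<Prod>h\<in>#hooks nu. rho1 (int t * h) 1 * rho1 (int t * h) (- 1)) *
            (\<Sum>h\<in>#hooks nu. rho2 (int t * h) 1 + rho2 (int t * h) (- 1)))"

text \<open>
  The ring \<open>\<complex>[x][[q]]\<close>: the variable \<open>q\<close> is \<^const>\<open>fps_X\<close>, and \<open>x\<close> is the polynomial
  variable of the coefficient ring.
\<close>

abbreviation q_var :: "complex poly fps" where "q_var \<equiv> fps_X"

definition x_var :: "complex poly fps" where "x_var = fps_const [:0, 1:]"

definition lift_series :: "complex fps \<Rightarrow> complex poly fps" where
  "lift_series F = Abs_fps (\<lambda>n. [:fps_nth F n:])"

text \<open>
  Division in \<open>\<complex>[x][[q]]\<close>: \<^typ>\<open>complex poly\<close> has no \<^const>\<open>inverse\<close>, but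
  \<^term>\<open>fps_right_inverse F 1\<close> is the inverse of \<^term>\<open>F\<close> when the constant term of \<^term>\<open>F\<close> is 1,
  which is the only case in which it is used. Integer powers are needed because
  \<open>(t - 3) / 2 = - 1\<close> for \<open>t = 1\<close>.
\<close>

definition unit_inverse :: "'a::comm_ring_1 fps \<Rightarrow> 'a fps" where
  "unit_inverse F = fps_right_inverse F 1"

definition unit_power :: "'a::comm_ring_1 fps \<Rightarrow> int \<Rightarrow> 'a fps" where
  "unit_power F n = (if n \<ge> 0 then F ^ nat n else unit_inverse F ^ nat (- n))"

text \<open>\<open>(a; p)\<^sub>\<infinity>\<close>, an infinite product in the usual topology on formal power series.\<close>

definition qpoch_inf :: "complex poly fps \<Rightarrow> complex poly fps \<Rightarrow> complex poly fps" where
  "qpoch_inf a p = (\<Prod>j. 1 - a * p ^ j)"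


section \<open>Well-definedness\<close>

lemma finite_partitions_of: "finite {la \<in> partitions. sum_list la = n}"
proof (rule finite_subset)
  show "{la \<in> partitions. sum_list la = n} \<subseteq> {xs. set xs \<subseteq> {..n} \<and> length xs \<le> n}"
  proof clarsimp
    fix la :: "nat list" assume "la \<in> partitions" and n: "n = sum_list la"
    hence "0 \<notin> set la" by (simp add: partitions_def is_partition_def)
    hence "length la \<le> sum_list la" by (induction la) auto
    moreover have "set la \<subseteq> {..sum_list la}" using member_le_sum_list by auto
    ultimately show "set la \<subseteq> {..sum_list la} \<and> length la \<le> sum_list la" by simp
  qed
  show "finite {xs. set xs \<subseteq> {..n} \<and> length xs \<le> n}"
    by (rule finite_lists_length_le) simp
qed

lemma unit_inverse: "fps_nth F 0 = 1 \<Longrightarrow> F * unit_inverse F = 1"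
  unfolding unit_inverse_def by (rule fps_right_inverse) simp

lemma qpoch_inf_has_prod:
  assumes "fps_nth a 0 = 0" "fps_nth p 0 = 0"
  shows "(\<lambda>j. 1 - a * p ^ j) has_prod qpoch_inf a p" and "fps_nth (qpoch_inf a p) 0 = 1"
proof -
  define f where "f j = 1 - a * p ^ j" for j
  have zero: "fps_nth (a * p ^ j) i = 0" if "i \<le> j" for i j
  proof -
    have *: "fps_nth (p ^ j) m = 0" if "m < j" for m
      using fps_pow_nth_below_subdegree[of m j p] assms(2) that
        startsby_zero_power_prefix[of p j] by auto
    show ?thesis
      unfolding fps_mult_nth
    proof (rule sum.neutral, rule ballI)
      fix l assume "l \<in> {0..i}"
      then show "fps_nth a l * fps_nth (p ^ j) (i - l) = 0"
        using assms(1) *[of "i - l"] that by (cases "l = 0") auto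
    qed
  qed
  have stable: "fps_nth (prod f {..n + k}) i = fps_nth (prod f {..n}) i" if "i \<le> n" for i n k
  proof (induction k)
    case (Suc k)
    have "fps_nth (prod f {..n + Suc k}) i =
        fps_nth (prod f {..n + k}) i - fps_nth (prod f {..n + k} * (a * p ^ (n + Suc k))) i"
      by (simp add: f_def algebra_simps)
    also have "fps_nth (prod f {..n + k} * (a * p ^ (n + Suc k))) i = 0"
      unfolding fps_mult_nth[of "prod f {..n + k}"]
      by (rule sum.neutral, rule ballI) (subst zero, use that in auto)
    finally show ?case using Suc by simp
  qed simp
  define L where "L = Abs_fps (\<lambda>i. fps_nth (prod f {..i}) i)"
  have "(\<lambda>n. \<Prod>j\<le>n. f j) \<longlonglongrightarrow> L"
  proof (rule tendsto_fpsI)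
    fix i
    show "eventually (\<lambda>n. fps_nth (prod f {..n}) i = fps_nth L i) sequentially"
      using eventually_ge_at_top[of i]
    proof eventually_elim
      case (elim n)
      then show ?case using stable[of i i "n - i"] by (simp add: L_def)
    qed
  qed
  moreover have L0: "fps_nth L 0 = 1" using assms by (simp add: L_def f_def)
  then have "L \<noteq> 0" by auto
  ultimately have "f has_prod L" by (simp add: has_prod_def raw_has_prod_def)
  moreover from this have "qpoch_inf a p = L"
    using has_prod_unique[of f L] by (simp add: qpoch_inf_def f_def[abs_def])
  ultimately show "(\<lambda>j. 1 - a * p ^ j) has_prod qpoch_inf a p" "fps_nth (qpoch_inf a p) 0 = 1"
    using L0 by (simp_all add: f_def[abs_def])
qed

lemma part_at_mono:
  assumes "is_partition la" "1 \<le> i" "i \<le> j"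
  shows "part_at la j \<le> part_at la i"
proof (cases "i < j \<and> j \<le> length la")
  case True
  then show ?thesis using assms sorted_wrt_nth_less[of "(\<ge>)" la "i - 1" "j - 1"]
    by (auto simp: part_at_def is_partition_def)
next
  case False
  then show ?thesis using assms by (cases "i = j") (auto simp: part_at_def)
qed

definition beta :: "nat list \<Rightarrow> nat \<Rightarrow> int" where
  "beta la i = int (part_at la i) - int i"

lemma beta_less:
  assumes "is_partition la" "1 \<le> i" "i < j"
  shows "beta la j < beta la i"
  using part_at_mono[OF assms(1,2), of j] assms(3) by (auto simp: beta_def)

lemma beta_inj:
  assumes "is_partition la" "1 \<le> i" "1 \<le> j" "beta la i = beta la j"
  shows "i = j"
  using beta_less[OF assms(1), of i j] beta_less[OF assms(1), of j i] assms
  by (metis less_irrefl linorder_neqE_nat)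

lemma beta_large: "length la < i \<Longrightarrow> beta la i = - int i"
  by (simp add: beta_def part_at_def)

definition depth :: "nat list \<Rightarrow> int \<Rightarrow> nat" where
  "depth la m = card {i. 1 \<le> i \<and> m \<le> beta la i}"

lemma depth_set:
  assumes "is_partition la"
  shows "{i. 1 \<le> i \<and> m \<le> beta la i} = {1..depth la m}"
proof -
  let ?S = "{i. 1 \<le> i \<and> m \<le> beta la i}"
  have fin: "finite ?S"
  proof (rule finite_subset)
    show "?S \<subseteq> {..max (length la) (nat (- m))}"
    proof
      fix i assume "i \<in> ?S"
      then show "i \<in> {..max (length la) (nat (- m))}"
        using beta_large[of la i] by (cases "length la < i") auto
    qed
  qed simp
  have down: "i \<in> ?S" if "j \<in> ?S" "1 \<le> i" "i \<le> j" for i j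
    using beta_less[OF assms, of i j] that by (cases "i = j") auto
  obtain r where r: "?S = {1..r}"
  proof (cases "?S = {}")
    case True
    then have "?S = {1..0}" by simp
    then show ?thesis by (rule that)
  next
    case False
    have "?S = {1..Max ?S}"
    proof (intro equalityI subsetI)
      fix i assume "i \<in> ?S"
      then show "i \<in> {1..Max ?S}" using Max_ge[OF fin, of i] by simp
    next
      fix i assume "i \<in> {1..Max ?S}"
      then show "i \<in> ?S" using down[of "Max ?S" i] Max_in[OF fin False] by simp
    qed
    then show ?thesis by (rule that)
  qed
  then have "depth la m = r" by (simp add: depth_def)
  with r show ?thesis by simp
qed

lemma depth_le_iff:
  assumes "is_partition la" "1 \<le> i"
  shows "i \<le> depth la m \<longleftrightarrow> m \<le> beta la i"
  using depth_set[OF assms(1), of m] assms(2) by (auto simp: set_eq_iff)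

definition beta_word :: "nat list \<Rightarrow> int \<Rightarrow> nat" where
  "beta_word la m = (if \<exists>i\<ge>1. m = int (part_at la i) - int i then 0 else 1)"

lemma beta_word_0_iff: "beta_word la m = 0 \<longleftrightarrow> (\<exists>i\<ge>1. beta la i = m)"
  by (auto simp: beta_word_def beta_def)

lemma beta_word_1_iff: "beta_word la m = 1 \<longleftrightarrow> \<not> (\<exists>i\<ge>1. beta la i = m)"
  by (auto simp: beta_word_def beta_def)

lemma depth_step:
  assumes "is_partition la"
  shows "depth la m = depth la (m + 1) + (if beta_word la m = 0 then 1 else 0)"
proof -
  have fin: "finite {i. 1 \<le> i \<and> m + 1 \<le> beta la i}"
    by (simp only: depth_set[OF assms] finite_atLeastAtMost)
  show ?thesis
  proof (cases "beta_word la m = 0")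
    case True
    then obtain i where i: "1 \<le> i" "beta la i = m" by (auto simp: beta_word_0_iff)
    have "{i. 1 \<le> i \<and> m \<le> beta la i} = insert i {i. 1 \<le> i \<and> m + 1 \<le> beta la i}"
      using i beta_inj[OF assms] by force
    then show ?thesis using True i fin by (simp add: depth_def)
  next
    case False
    then have "m \<le> beta la i \<longleftrightarrow> m + 1 \<le> beta la i" if "1 \<le> i" for i
      using that unfolding beta_word_0_iff by (metis add1_zle_eq order_le_less)
    then have "{i. 1 \<le> i \<and> m \<le> beta la i} = {i. 1 \<le> i \<and> m + 1 \<le> beta la i}"
      by blast
    then show ?thesis using False by (simp add: depth_def)
  qed
qed

lemma depth_nonneg:
  assumes "is_partition la"
  shows "int (part_at la (depth la m + 1)) \<le> m + int (depth la m)"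
  using depth_le_iff[OF assms, of "depth la m + 1" m] by (simp add: beta_def)

definition border_point :: "nat list \<Rightarrow> int \<Rightarrow> nat \<times> nat" where
  "border_point la m = (depth la m, nat (m + int (depth la m)))"

lemma border_point_in:
  assumes "is_partition la"
  shows "border_point la m \<in> border la"
proof -
  let ?r = "depth la m"
  have "(?r + 1, nat (m + int ?r) + 1) \<notin> boxes la"
    using depth_nonneg[OF assms, of m] by (auto simp: boxes_def)
  moreover have "(?r, nat (m + int ?r)) \<in> boxes la" if "?r \<noteq> 0" "nat (m + int ?r) \<noteq> 0"
    using that depth_le_iff[OF assms, of ?r m] by (auto simp: boxes_def beta_def)
  ultimately show ?thesis by (auto simp: border_def border_point_def)
qed

lemma border_unique:
  assumes "is_partition la" "(r, k) \<in> border la" "(r', k') \<in> border la"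
    "int k - int r = int k' - int r'"
  shows "r = r' \<and> k = k'"
proof -
  have *: False if "(r, k) \<in> border la" "(r', k') \<in> border la"
    "int k - int r = int k' - int r'" "r < r'" for r k r' k'
  proof -
    have "k < k'" using that by linarith
    then have "(r', k') \<in> boxes la" using that by (auto simp: border_def)
    then have "(r + 1, k + 1) \<in> boxes la"
      using part_at_mono[OF assms(1), of "r + 1" r'] that \<open>k < k'\<close> by (auto simp: boxes_def)
    then show False using that by (auto simp: border_def)
  qed
  have "r = r'" using *[of r k r' k'] *[of r' k' r k] assms by (metis linorder_neqE_nat)
  then show ?thesis using assms by auto
qed

lemma is_border_word_beta_word:
  assumes "is_partition la"
  shows "is_border_word la (beta_word la)"
  unfolding is_border_word_def
proof (intro exI[of _ "border_point la"] allI conjI)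
  fix m
  show "border_point la m \<in> border la" by (rule border_point_in[OF assms])
  show "beta_word la m = 0 \<and> fst (border_point la m) = fst (border_point la (m + 1)) + 1 \<and>
        snd (border_point la (m + 1)) = snd (border_point la m) \<or>
        beta_word la m = 1 \<and> fst (border_point la (m + 1)) = fst (border_point la m) \<and>
        snd (border_point la (m + 1)) = snd (border_point la m) + 1"
    using depth_step[OF assms, of m] depth_nonneg[OF assms, of m]
    by (auto simp: border_point_def beta_word_def nat_add_distrib split: if_splits)
qed

lemma border_word_shift:
  assumes "is_partition la" "is_border_word la c"
  obtains s where "\<And>m. c m = beta_word la (m + s)"
proof -
  from assms(2) obtain P where
    P: "\<And>m. P m \<in> border la" and
    step: "\<And>m. (c m = 0 \<and> fst (P m) = fst (P (m + 1)) + 1 \<and> snd (P (m + 1)) = snd (P m) \<or>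
      c m = 1 \<and> fst (P (m + 1)) = fst (P m) \<and> snd (P (m + 1)) = snd (P m) + 1)"
    unfolding is_border_word_def by blast
  define d where "d m = int (snd (P m)) - int (fst (P m))" for m
  have d1: "d (m + 1) = d m + 1" for m using step[of m] by (auto simp: d_def)
  have d: "d m = m + d 0" for m
  proof (induction m rule: int_induct[where k = 0])
    case (step2 i)
    then show ?case using d1[of "i - 1"] by simp
  qed (use d1 in auto)
  have PP: "P m = border_point la (m + d 0)" for m
  proof -
    have "fst (P m) = depth la (m + d 0) \<and> snd (P m) = nat (m + d 0 + int (depth la (m + d 0)))"
      by (rule border_unique[OF assms(1)])
        (use P[of m] border_point_in[OF assms(1), of "m + d 0"] d[of m]
          depth_nonneg[OF assms(1), of "m + d 0"] in \<open>auto simp: border_point_def d_def\<close>)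
    then show ?thesis by (simp add: border_point_def prod_eq_iff)
  qed
  have "c m = beta_word la (m + d 0)" for m
    using step[of m] depth_step[OF assms(1), of "m + d 0"]
    by (auto simp: PP border_point_def add_ac beta_word_def split: if_splits)
  then show ?thesis by (rule that)
qed

lemma card_zeros: 
  assumes "is_partition la"
  shows "card {i. i \<ge> 0 \<and> beta_word la (i + s) = 0} = depth la s"
proof -
  have "bij_betw (\<lambda>i. beta la i - s) {i. 1 \<le> i \<and> s \<le> beta la i}
          {i. i \<ge> 0 \<and> beta_word la (i + s) = 0}"
    unfolding bij_betw_def
  proof
    show "inj_on (\<lambda>i. beta la i - s) {i. 1 \<le> i \<and> s \<le> beta la i}"
      by (rule inj_onI) (use beta_inj[OF assms] in auto)
    show "(\<lambda>i. beta la i - s) ` {i. 1 \<le> i \<and> s \<le> beta la i} =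
          {i. i \<ge> 0 \<and> beta_word la (i + s) = 0}"
      by (force simp: beta_word_0_iff image_iff)
  qed
  then show ?thesis by (simp add: bij_betw_same_card depth_def)
qed

lemma card_ones:
  assumes "is_partition la"
  shows "int (card {i. i \<le> - 1 \<and> beta_word la (i + s) = 1}) = s + int (depth la s)"
proof -
  define N where "N = max (length la + 1) (nat (- s) + depth la s)"
  have "N > length la" by (auto simp: N_def)
  have Ns: "- int N \<le> s" by (auto simp: N_def)
  define Z where "Z = {i. depth la s < i \<and> i \<le> N}"
  have low: "\<exists>i\<ge>1. beta la i = m" if "m < - int N" for m
    by (rule exI[of _ "nat (- m)"]) (use that \<open>N > length la\<close> beta_large in auto)
  have range: "beta la i \<ge> - int N \<longleftrightarrow> i \<le> N" if "i \<ge> 1" for i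
  proof (cases "i \<le> N")
    case True then show ?thesis by (auto simp: beta_def)
  next
    case False then show ?thesis using beta_large[of la i] \<open>N > length la\<close> by auto
  qed
  have "{i. i \<le> - 1 \<and> beta_word la (i + s) = 1} =
        (\<lambda>m. m - s) ` ({- int N..<s} - beta la ` Z)"
  proof (intro equalityI subsetI)
    fix i assume "i \<in> {i. i \<le> - 1 \<and> beta_word la (i + s) = 1}"
    then have i: "i \<le> - 1" "\<not> (\<exists>j\<ge>1. beta la j = i + s)" by (auto simp: beta_word_1_iff simp del: One_nat_def)
    then have "- int N \<le> i + s" using low[of "i + s"] by force
    moreover have "i + s \<notin> beta la ` Z"
    proof
      assume "i + s \<in> beta la ` Z"
      then obtain j where "j \<in> Z" "beta la j = i + s" by auto
      moreover from this have "j \<ge> 1" by (auto simp: Z_def)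
      ultimately show False using i(2) by blast
    qed
    ultimately have "i + s \<in> {- int N..<s} - beta la ` Z" using i(1) by simp
    then show "i \<in> (\<lambda>m. m - s) ` ({- int N..<s} - beta la ` Z)" by (force simp: image_iff)
  next
    fix i assume "i \<in> (\<lambda>m. m - s) ` ({- int N..<s} - beta la ` Z)"
    then obtain m where m: "i = m - s" "- int N \<le> m" "m < s" "m \<notin> beta la ` Z" by auto
    have "beta la j \<noteq> m" if "j \<ge> 1" for j
    proof
      assume "beta la j = m"
      then have "j \<in> Z" using m that range[of j] depth_le_iff[OF assms that, of s]
        by (auto simp: Z_def)
      then show False using m \<open>beta la j = m\<close> by auto
    qed
    then show "i \<in> {i. i \<le> - 1 \<and> beta_word la (i + s) = 1}"
      using m by (auto simp: beta_word_1_iff simp del: One_nat_def)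
  qed
  then have "card {i. i \<le> - 1 \<and> beta_word la (i + s) = 1} = card ({- int N..<s} - beta la ` Z)"
    by (simp add: card_image)
  also have sub: "beta la ` Z \<subseteq> {- int N..<s}"
  proof
    fix m assume "m \<in> beta la ` Z"
    then obtain i where i: "m = beta la i" "depth la s < i" "i \<le> N" by (auto simp: Z_def)
    then show "m \<in> {- int N..<s}"
      using range[of i] depth_le_iff[OF assms, of i s] by auto
  qed
  then have "card ({- int N..<s} - beta la ` Z) = card {- int N..<s} - card (beta la ` Z)"
    by (intro card_Diff_subset) (auto intro: finite_subset)
  also have "card (beta la ` Z) = card Z"
    by (rule card_image, rule inj_onI) (use beta_inj[OF assms] in \<open>auto simp: Z_def\<close>)
  also have "Z = {depth la s<..N}" by (auto simp: Z_def)
  finally have "card {i. i \<le> - 1 \<and> beta_word la (i + s) = 1} =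
      nat (s + int N) - (N - depth la s)" by simp
  moreover have "depth la s \<le> N" by (auto simp: N_def)
  moreover have "s + int (depth la s) \<ge> 0" using depth_nonneg[OF assms, of s] by linarith
  ultimately show ?thesis using Ns by simp
qed

text \<open>The explicit form of the word, which also shows that \<^const>\<open>word\<close> is well defined.\<close>

lemma word_eq:
  assumes "is_partition la"
  shows "word la m = (if \<exists>i\<ge>1. m = int (part_at la i) - int i then 0 else 1)"
proof -
  have "word la = beta_word la"
    unfolding word_def
  proof (rule the_equality, intro conjI)
    show "is_border_word la (beta_word la)" by (rule is_border_word_beta_word[OF assms])
    show "card {i. i \<le> - 1 \<and> beta_word la i = 1} = card {i. i \<ge> 0 \<and> beta_word la i = 0}"
      using card_ones[OF assms, of 0] card_zeros[OF assms, of 0] by simp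
  next
    fix c assume c: "is_border_word la c \<and>
      card {i. i \<le> - 1 \<and> c i = 1} = card {i. i \<ge> 0 \<and> c i = 0}"
    then obtain s where s: "\<And>m. c m = beta_word la (m + s)"
      using border_word_shift[OF assms] by blast
    then have "s = 0" using c card_ones[OF assms, of s] card_zeros[OF assms, of s] by simp
    with s show "c = beta_word la" by auto
  qed
  then show ?thesis by (simp add: beta_word_def)
qed

end

theory Submission
  imports Defs
begin

text \<open>
  The zeros of the word of a self-conjugate partition form a set of integers \<open>Z\<close> in which exactly one
  of \<open>m\<close> and \<open>-1 - m\<close> lies, so the partition amounts to the finite set \<open>D\<close> of its nonnegative zeros, and
  its size is the sum of \<open>2b + 1\<close> over \<open>b \<in> D\<close> (the diagonal hooks). Boxes correspond to pairs
  \<open>a < b\<close> with \<open>a \<notin> Z\<close> and \<open>b \<in> Z\<close>, the hook length being \<open>b - a\<close>; it is divisible by \<open>t\<close> when \<open>a\<close> and \<open>b\<close> lie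
  on the same runner modulo \<open>t\<close>. The reflection \<open>(a, b) \<mapsto> (-1 - b, -1 - a)\<close> exchanges the runners \<open>k\<close> and
  \<open>t - 1 - k\<close>, keeps hooks and flips signs, so each runner \<open>k < (t - 1)/2\<close> is an independent integer
  (its charge) together with a partition, each of whose hooks \<open>h\<close> is seen once with each sign as \<open>t h\<close>.
  Hence the left-hand side is the product of the charge series \<open>\<theta>\<^sub>k\<close> times \<open>m f\<^bsup>m-1\<^esup> g\<close>, \<open>m = (t - 1)/2\<close>.
  The same decomposition of all finite sets \<open>D\<close> with trivial weights evaluates the product of the
  \<open>\<theta>\<^sub>k\<close>, so that no triple product identity is needed.
\<close>

section \<open>Zeros of the border word\<close>

lemma initial_segment:
  fixes S :: "nat set"
  assumes "finite S" "\<And>i. i \<in> S \<Longrightarrow> 1 \<le> i" "\<And>i j. j \<in> S \<Longrightarrow> 1 \<le> i \<Longrightarrow> i \<le> j \<Longrightarrow> i \<in> S"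
  shows "S = {1..card S}"
proof (cases "S = {}")
  case False
  have "S = {1..Max S}"
  proof (intro equalityI subsetI)
    fix i assume "i \<in> S"
    then show "i \<in> {1..Max S}" using assms(2) Max_ge[OF assms(1)] by simp
  next
    fix i assume "i \<in> {1..Max S}"
    then show "i \<in> S" using assms(3)[OF Max_in[OF assms(1) False], of i] by simp
  qed
  then show ?thesis by (metis card_atLeastAtMost diff_Suc_1)
qed simp

lemma nat_eqI_le:
  fixes a b :: nat
  assumes "\<And>i. 1 \<le> i \<Longrightarrow> i \<le> a \<longleftrightarrow> i \<le> b"
  shows "a = b"
  using assms[of a] assms[of b] by (cases "a = 0"; cases "b = 0") auto

lemma part_at_pos_iff:
  assumes "is_partition la"
  shows "0 < part_at la i \<longleftrightarrow> 1 \<le> i \<and> i \<le> length la"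
proof -
  have "la ! (i - 1) \<noteq> 0" if "1 \<le> i" "i \<le> length la"
  proof -
    have "la ! (i - 1) \<in> set la" using that by (intro nth_mem) simp
    then show ?thesis using assms unfolding is_partition_def by metis
  qed
  then show ?thesis by (auto simp: part_at_def simp del: One_nat_def)
qed

lemma partition_eqI:
  assumes "is_partition la" "is_partition mu" "\<And>i. 1 \<le> i \<Longrightarrow> part_at la i = part_at mu i"
  shows "la = mu"
proof (rule nth_equalityI)
  have "i \<le> length la \<longleftrightarrow> i \<le> length mu" if "1 \<le> i" for i
    using part_at_pos_iff[OF assms(1), of i] part_at_pos_iff[OF assms(2), of i] assms(3)[OF that] that
    by simp
  then show len: "length la = length mu"
    by (rule nat_eqI_le)
  fix i assume "i < length la"
  then show "la ! i = mu ! i" using assms(3)[of "Suc i"] len by (simp add: part_at_def)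
qed

lemma conjugate_set:
  assumes "is_partition la" "1 \<le> j"
  shows "{i. 1 \<le> i \<and> j \<le> part_at la i} = {1..part_at (conjugate la) j}"
proof -
  let ?S = "{i. 1 \<le> i \<and> j \<le> part_at la i}"
  have sub: "?S \<subseteq> {1..length la}"
    using assms(2) by (auto simp: part_at_def split: if_splits)
  have seg: "?S = {1..card ?S}"
  proof (rule initial_segment)
    show "finite ?S" using sub by (rule finite_subset) simp
    show "i \<in> ?S" if "k \<in> ?S" "1 \<le> i" "i \<le> k" for i k
      using part_at_mono[OF assms(1) that(2,3)] that by auto
  qed auto
  have "part_at (conjugate la) j = card ?S"
  proof (cases "j \<le> part_at la 1")
    case True
    have "[1..<Suc (part_at la 1)] ! (j - 1) = j" using True assms(2) by (subst nth_upt) auto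
    then show ?thesis using True assms(2)
      by (simp add: part_at_def[of "map f xs" for f xs] conjugate_def del: upt_Suc One_nat_def)
  next
    case False
    have "?S = {}"
      using False part_at_mono[OF assms(1), of 1] order_trans by blast
    then have "card ?S = 0" by (simp only: card.empty)
    then show ?thesis using False
      by (simp add: part_at_def[of "map f xs" for f xs] conjugate_def del: upt_Suc One_nat_def)
  qed
  with seg show ?thesis by simp
qed

text \<open>The columns are initial segments because the parts decrease. This equivalence makes rows
  and columns symmetric, and the arguments about the border use it in place of the list that defines
  \<open>conjugate\<close>.\<close>

lemma le_conjugate_iff:
  assumes "is_partition la" "1 \<le> i" "1 \<le> j"
  shows "i \<le> part_at (conjugate la) j \<longleftrightarrow> j \<le> part_at la i"
  using conjugate_set[OF assms(1,3)] assms(2) by (auto simp: set_eq_iff)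

lemma is_partition_conjugate:
  assumes "is_partition la"
  shows "is_partition (conjugate la)"
proof -
  have len: "length (conjugate la) = part_at la 1" by (simp add: conjugate_def)
  have nth: "conjugate la ! j = part_at (conjugate la) (Suc j)" if "j < part_at la 1" for j
    using that len by (simp add: part_at_def)
  have "part_at (conjugate la) (Suc j) \<le> part_at (conjugate la) (Suc i)" if "i \<le> j" for i j
  proof (cases "part_at (conjugate la) (Suc j) = 0")
    case False
    then have "Suc j \<le> part_at la (part_at (conjugate la) (Suc j))"
      using le_conjugate_iff[OF assms, of "part_at (conjugate la) (Suc j)" "Suc j"] by simp
    then show ?thesis
      using le_conjugate_iff[OF assms, of "part_at (conjugate la) (Suc j)" "Suc i"] that False by simp
  qed simp
  moreover have "0 < part_at (conjugate la) (Suc j)" if "j < part_at la 1" for j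
    using le_conjugate_iff[OF assms, of 1 "Suc j"] that by simp
  ultimately show ?thesis
    unfolding is_partition_def
    by (auto simp: sorted_wrt_iff_nth_less in_set_conv_nth len nth simp del: One_nat_def)
qed

text \<open>The positions of the zeros of \<open>word la\<close>, also known as the beta-set or Maya
  diagram of the partition. As a set of integers it can be reflected, translated and cut into
  residue classes.\<close>

definition maya :: "nat list \<Rightarrow> int set" where
  "maya la = beta la ` {1..}"

lemma maya_iff: "m \<in> maya la \<longleftrightarrow> (\<exists>i\<ge>1. beta la i = m)"
  by (auto simp: maya_def)

lemma maya_Nil: "maya [] = {..<0}"
proof (intro equalityI subsetI)
  fix x assume "x \<in> maya []"
  then show "x \<in> {..<0}" by (auto simp: maya_def beta_def part_at_def)
next
  fix x :: int assume "x \<in> {..<0}"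
  then have "beta [] (nat (- x)) = x" "1 \<le> nat (- x)" by (auto simp: beta_def part_at_def)
  then show "x \<in> maya []" unfolding maya_iff by blast
qed

text \<open>The right-hand side depends on \<open>la\<close> only through \<open>maya la\<close>,
  which is what allows a partition to be recovered from its zeros.\<close>

lemma depth_eq_card:
  assumes "is_partition la"
  shows "depth la m = card (maya la \<inter> {m..})"
proof -
  have "maya la \<inter> {m..} = beta la ` {i. 1 \<le> i \<and> m \<le> beta la i}" by (auto simp: maya_def)
  moreover have "inj_on (beta la) {i. 1 \<le> i \<and> m \<le> beta la i}"
    by (rule inj_onI) (use beta_inj[OF assms] in auto)
  ultimately show ?thesis by (simp add: depth_def card_image)
qed

text \<open>By \<open>depth_le_iff\<close> the depths determine every beta number, and the depths
  are counts in the set of zeros.\<close>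

lemma maya_inj:
  assumes "is_partition la" "is_partition mu" "maya la = maya mu"
  shows "la = mu"
proof (rule partition_eqI[OF assms(1,2)])
  fix i :: nat assume i: "1 \<le> i"
  have "m \<le> beta la i \<longleftrightarrow> m \<le> beta mu i" for m
    using depth_le_iff[OF assms(1) i, of m] depth_le_iff[OF assms(2) i, of m]
      depth_eq_card[OF assms(1), of m] depth_eq_card[OF assms(2), of m] assms(3) by simp
  then have "beta la i = beta mu i" by (metis order_antisym order_refl)
  then show "part_at la i = part_at mu i" by (simp add: beta_def)
qed

section \<open>Conjugation as reflection of the border word\<close>

lemma beta_conjugate_pair:
  assumes "is_partition la" "1 \<le> i" "1 \<le> j"
  shows "j \<le> part_at la i \<Longrightarrow> -1 - beta (conjugate la) j < beta la i"
    and "\<not> j \<le> part_at la i \<Longrightarrow> beta la i < -1 - beta (conjugate la) j"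
  using le_conjugate_iff[OF assms] by (auto simp: beta_def)

lemma mem_reflect_iff: "x \<in> (\<lambda>m. -1 - m) ` S \<longleftrightarrow> -1 - x \<in> S" for x :: int
proof
  assume "-1 - x \<in> S"
  then have "-1 - (-1 - x) \<in> (\<lambda>m. -1 - m) ` S" by (rule imageI)
  then show "x \<in> (\<lambda>m. -1 - m) ` S" by simp
qed auto

text \<open>Transposing the diagram reverses the border and exchanges horizontal and vertical steps,
  so the ones of \<open>la\<close> are the reflected zeros of its conjugate.\<close>

lemma compl_maya:
  assumes "is_partition la"
  shows "- maya la = (\<lambda>m. -1 - m) ` maya (conjugate la)"
proof (intro equalityI subsetI)
  fix m assume "m \<in> - maya la"
  then have m: "beta la i \<noteq> m" if "1 \<le> i" for i using that by (auto simp: maya_iff simp del: One_nat_def)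
  define r where "r = depth la m"
  have r: "i \<le> r \<longleftrightarrow> m < beta la i" if "1 \<le> i" for i
    using depth_le_iff[OF assms that, of m] m[OF that] by (auto simp: r_def)
  have "beta la (r + 1) < m" using r[of "r + 1"] m[of "r + 1"] by simp
  then have pos: "0 < m + 1 + int r" by (simp add: beta_def)
  \<comment> \<open>The horizontal step \<open>m\<close> lies at depth \<open>r\<close> and runs
    from abscissa \<open>m + r\<close> to \<open>m + r + 1\<close>, so it is the bottom edge of
    column \<open>j\<close>, which therefore has \<open>r\<close> boxes.\<close>
  define j where "j = nat (m + 1 + int r)"
  have j: "1 \<le> j" "int j = m + 1 + int r" using pos by (auto simp: j_def)
  have "i \<le> part_at (conjugate la) j \<longleftrightarrow> i \<le> r" if "1 \<le> i" for i
  proof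
    assume "i \<le> r"
    then have "part_at la r \<le> part_at la i" "m < beta la r"
      using part_at_mono[OF assms that] r[of r] that by auto
    then show "i \<le> part_at (conjugate la) j"
      using le_conjugate_iff[OF assms that j(1)] j(2) by (auto simp: beta_def)
  next
    assume *: "i \<le> part_at (conjugate la) j"
    show "i \<le> r"
    proof (rule ccontr)
      assume "\<not> i \<le> r"
      then have "part_at la i \<le> part_at la (r + 1)" using part_at_mono[OF assms, of "r + 1" i] by simp
      then show False using * le_conjugate_iff[OF assms that j(1)] j(2) \<open>beta la (r + 1) < m\<close>
        by (auto simp: beta_def)
    qed
  qed
  then have "part_at (conjugate la) j = r"
    by (rule nat_eqI_le)
  then have "m = -1 - beta (conjugate la) j" using j(2) by (simp add: beta_def)
  then show "m \<in> (\<lambda>m. -1 - m) ` maya (conjugate la)" using j(1) by (auto simp: maya_def)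
next
  fix m assume "m \<in> (\<lambda>m. -1 - m) ` maya (conjugate la)"
  then obtain j where j: "1 \<le> j" "m = -1 - beta (conjugate la) j" by (auto simp: maya_def)
  have "beta la i \<noteq> m" if "1 \<le> i" for i
    using beta_conjugate_pair[OF assms that j(1)] j(2) by (cases "j \<le> part_at la i") auto
  then show "m \<in> - maya la" by (auto simp: maya_iff)
qed

text \<open>By \<open>compl_maya\<close>, self-conjugacy means that the reflection
  \<open>m \<mapsto> -1 - m\<close> exchanges the set of zeros with its complement.\<close>

lemma self_conjugate_iff:
  assumes "is_partition la"
  shows "conjugate la = la \<longleftrightarrow> (\<forall>m. m \<in> maya la \<longleftrightarrow> -1 - m \<notin> maya la)"
proof
  assume eq: "conjugate la = la"
  have "x \<notin> maya la \<longleftrightarrow> -1 - x \<in> maya la" for x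
  proof -
    have "x \<notin> maya la \<longleftrightarrow> x \<in> (\<lambda>m. -1 - m) ` maya la"
      using compl_maya[OF assms] unfolding eq by (metis Compl_iff)
    then show ?thesis by (simp only: mem_reflect_iff)
  qed
  then show "\<forall>m. m \<in> maya la \<longleftrightarrow> -1 - m \<notin> maya la" by blast
next
  assume sym: "\<forall>m. m \<in> maya la \<longleftrightarrow> -1 - m \<notin> maya la"
  have "maya (conjugate la) = maya la"
  proof (intro set_eqI)
    fix m
    have "m \<in> maya (conjugate la) \<longleftrightarrow> -1 - m \<in> (\<lambda>m. -1 - m) ` maya (conjugate la)"
      by (simp add: mem_reflect_iff)
    also have "\<dots> \<longleftrightarrow> -1 - m \<notin> maya la" using compl_maya[OF assms] by (metis Compl_iff)
    finally show "m \<in> maya (conjugate la) \<longleftrightarrow> m \<in> maya la" using sym by blast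
  qed
  then show "conjugate la = la"
    using maya_inj[OF is_partition_conjugate[OF assms] assms] by simp
qed

section \<open>Hooks as inversions\<close>

definition inversions :: "int set \<Rightarrow> (int \<times> int) set" where
  "inversions Z = {(a, b). a \<notin> Z \<and> b \<in> Z \<and> a < b}"

text \<open>A box is paired with the horizontal border step that ends its column and the vertical
  step that ends its row. By \<open>beta_conjugate_pair\<close> the former precedes the latter
  precisely when \<open>(i, j)\<close> is a box.\<close>

lemma bij_betw_boxes_inversions:
  assumes "is_partition la"
  shows "bij_betw (\<lambda>(i, j). (-1 - beta (conjugate la) j, beta la i)) (boxes la) (inversions (maya la))"
  unfolding bij_betw_def
proof
  let ?f = "\<lambda>(i, j). (-1 - beta (conjugate la) j, beta la i)"
  note conj = is_partition_conjugate[OF assms]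
  show "inj_on ?f (boxes la)"
    by (rule inj_onI) (use beta_inj[OF assms] beta_inj[OF conj] in \<open>auto simp: boxes_def\<close>)
  show "?f ` boxes la = inversions (maya la)"
  proof (intro equalityI subsetI)
    fix p assume "p \<in> ?f ` boxes la"
    then obtain i j where p: "p = (-1 - beta (conjugate la) j, beta la i)" "1 \<le> i" "1 \<le> j" "j \<le> part_at la i"
      by (auto simp: boxes_def)
    have "-1 - beta (conjugate la) j \<in> - maya la"
      unfolding compl_maya[OF assms] maya_iff using p by (auto simp: maya_def)
    then show "p \<in> inversions (maya la)"
      using p beta_conjugate_pair(1)[OF assms p(2,3,4)] by (auto simp: inversions_def maya_iff)
  next
    fix p assume "p \<in> inversions (maya la)"
    then obtain a b where p: "p = (a, b)" "a \<in> - maya la" "b \<in> maya la" "a < b"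
      by (auto simp: inversions_def)
    then obtain i j where ij: "1 \<le> i" "b = beta la i" "1 \<le> j" "a = -1 - beta (conjugate la) j"
      unfolding compl_maya[OF assms] by (auto simp: maya_def)
    then have "(i, j) \<in> boxes la" "p = ?f (i, j)"
      using beta_conjugate_pair(2)[OF assms ij(1,3)] p by (force simp: boxes_def)+
    then show "p \<in> ?f ` boxes la" by blast
  qed
qed

lemma hook_eq: "hook la (i, j) = beta la i - (-1 - beta (conjugate la) j)"
  by (simp add: hook_def beta_def)

lemma boxes_eq_Sigma: "boxes la = Sigma {1..length la} (\<lambda>i. {1..part_at la i})"
  by (auto simp: boxes_def part_at_def split: if_splits simp del: One_nat_def)

lemma finite_boxes [simp]: "finite (boxes la)"
  by (simp add: boxes_eq_Sigma)

lemma sum_part_at: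
  assumes "length la \<le> n"
  shows "(\<Sum>i = 1..n. part_at la i) = sum_list la"
proof -
  have "(\<Sum>i = 1..n. part_at la i) = (\<Sum>i = 1..length la. part_at la i)"
    by (rule sum.mono_neutral_right) (use assms in \<open>auto simp: part_at_def\<close>)
  also have "\<dots> = (\<Sum>i<length la. la ! i)"
    by (rule sum.reindex_bij_witness[of _ Suc "\<lambda>i. i - 1"]) (auto simp: part_at_def)
  finally show ?thesis by (simp add: sum_list_sum_nth atLeast0LessThan)
qed

lemma card_boxes: "card (boxes la) = sum_list la"
  by (simp add: boxes_eq_Sigma sum_part_at del: One_nat_def)

lemma finite_inversions:
  assumes "is_partition la"
  shows "finite (inversions (maya la))"
  using bij_betw_finite[OF bij_betw_boxes_inversions[OF assms]] by simp

definition inversion_hooks :: "int set \<Rightarrow> int multiset" where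
  "inversion_hooks Z = image_mset (\<lambda>(a, b). b - a) (mset_set (inversions Z))"

lemma image_mset_mset_set_bij:
  assumes "bij_betw f A B" "\<And>x. x \<in> A \<Longrightarrow> h (f x) = g x"
  shows "image_mset h (mset_set B) = image_mset g (mset_set A)"
proof -
  have "image_mset g (mset_set A) = image_mset (h \<circ> f) (mset_set A)"
    using assms(2) by (cases "finite A") (auto intro!: image_mset_cong)
  also have "\<dots> = image_mset h (mset_set (f ` A))"
    using assms(1) by (subst image_mset_mset_set[symmetric]) (simp_all add: bij_betw_def multiset.map_comp)
  finally show ?thesis using assms(1) by (simp add: bij_betw_def)
qed

lemma inversion_hooks_maya:
  assumes "is_partition la"
  shows "inversion_hooks (maya la) = hooks la"
  unfolding inversion_hooks_def hooks_def
  by (rule image_mset_mset_set_bij[OF bij_betw_boxes_inversions[OF assms]]) (auto simp: hook_eq)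

lemma bij_betw_inversions_shift:
  "bij_betw (\<lambda>(a, b). (s + a, s + b)) (inversions Z) (inversions ((+) s ` Z))"
  by (rule bij_betw_byWitness[of _ "\<lambda>(a, b). (a - s, b - s)"]) (auto simp: inversions_def image_iff)

text \<open>Hook lengths are differences of positions, so they do not see the charge.\<close>

lemma inversion_hooks_shift: "inversion_hooks ((+) s ` Z) = inversion_hooks Z"
  unfolding inversion_hooks_def
  by (rule image_mset_mset_set_bij[OF bij_betw_inversions_shift]) auto

section \<open>Charged sets\<close>

text \<open>
  The renormalised sum of \<open>f\<close> over \<open>Z\<close>, relative to the negative integers; \<open>f = 1\<close> gives the charge,
  which for a word counts its shift against the indexing of \<^const>\<open>word\<close>.
\<close>

definition reg_sum :: "(int \<Rightarrow> int) \<Rightarrow> int set \<Rightarrow> int" where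
  "reg_sum f Z = (\<Sum>i\<in>Z \<inter> {0..}. f i) - (\<Sum>i\<in>{..<0} - Z. f i)"

text \<open>Adding the elements of \<open>Z\<close> in \<open>{N..<0}\<close> to both sums leaves
  the difference unchanged and turns the sum over gaps into one over a full interval, which has a
  closed form.\<close>

lemma reg_sum_cutoff:
  assumes "N \<le> 0" "{..<N} \<subseteq> Z" "finite (Z \<inter> {0..})"
  shows "reg_sum f Z = (\<Sum>i\<in>Z \<inter> {N..}. f i) - (\<Sum>i\<in>{N..<0}. f i)"
proof -
  have 1: "Z \<inter> {N..} = (Z \<inter> {0..}) \<union> (Z \<inter> {N..<0})" and 2: "{..<0} - Z = {N..<0} - Z"
    using assms by (auto simp: subset_iff not_less)
  have "(\<Sum>i\<in>Z \<inter> {N..}. f i) = (\<Sum>i\<in>Z \<inter> {0..}. f i) + (\<Sum>i\<in>Z \<inter> {N..<0}. f i)"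
    unfolding 1 by (rule sum.union_disjoint) (use assms in auto)
  moreover have "(\<Sum>i\<in>{N..<0}. f i) = (\<Sum>i\<in>Z \<inter> {N..<0}. f i) + (\<Sum>i\<in>{N..<0} - Z. f i)"
    using sum.Int_Diff[of "{N..<0}" f Z] by (simp add: Int_commute)
  ultimately show ?thesis by (simp add: reg_sum_def 2)
qed

text \<open>Rows beyond the last part are empty and have beta number \<open>- int i\<close>. Hence
  every position below \<open>s - int n\<close> is filled, and those from there on come from the
  first \<open>n\<close> rows.\<close>

lemma maya_shift_tail:
  assumes "is_partition nu" "length nu \<le> n"
  shows "(+) s ` maya nu \<inter> {s - int n..} = (\<lambda>i. beta nu i + s) ` {1..n}"
    and "{..<s - int n} \<subseteq> (+) s ` maya nu"
proof -
  have range: "- int n \<le> beta nu i \<longleftrightarrow> i \<le> n" if "i \<ge> 1" for i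
    using that beta_large[of nu i] assms(2) by (cases "i \<le> n") (auto simp: beta_def)
  show "(+) s ` maya nu \<inter> {s - int n..} = (\<lambda>i. beta nu i + s) ` {1..n}"
  proof (intro equalityI subsetI)
    fix x assume "x \<in> (+) s ` maya nu \<inter> {s - int n..}"
    then obtain i where "1 \<le> i" "x = s + beta nu i" "- int n \<le> beta nu i" by (auto simp: maya_def)
    then show "x \<in> (\<lambda>i. beta nu i + s) ` {1..n}" using range[of i] by auto
  next
    fix x assume "x \<in> (\<lambda>i. beta nu i + s) ` {1..n}"
    then obtain i where "1 \<le> i" "x = s + beta nu i" "i \<le> n" by auto
    then show "x \<in> (+) s ` maya nu \<inter> {s - int n..}" using range[of i] by (auto simp: maya_def)
  qed
  show "{..<s - int n} \<subseteq> (+) s ` maya nu"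
  proof
    fix x assume x: "x \<in> {..<s - int n}"
    then have "beta nu (nat (s - x)) = - int (nat (s - x))" "1 \<le> nat (s - x)"
      using assms(2) beta_large[of nu "nat (s - x)"] by (auto simp: nat_less_iff zless_nat_eq_int_zless)
    then have "x - s \<in> maya nu" using x unfolding maya_iff by (intro exI[of _ "nat (s - x)"]) auto
    then have "s + (x - s) \<in> (+) s ` maya nu" by (rule imageI)
    then show "x \<in> (+) s ` maya nu" by simp
  qed
qed

lemma finite_shifted_maya:
  assumes "is_partition nu"
  shows "finite ((+) s ` maya nu \<inter> {m..})" "finite ({..<m} - (+) s ` maya nu)"
proof -
  define n where "n = max (length nu) (nat (s - m))"
  have "(+) s ` maya nu \<inter> {m..} \<subseteq> (+) s ` maya nu \<inter> {s - int n..}" by (auto simp: n_def)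
  also have "\<dots> = (\<lambda>i. beta nu i + s) ` {1..n}"
    by (rule maya_shift_tail(1)[OF assms]) (simp add: n_def)
  finally show "finite ((+) s ` maya nu \<inter> {m..})" by (rule finite_subset) simp
  have "{..<s - int n} \<subseteq> (+) s ` maya nu"
    by (rule maya_shift_tail(2)[OF assms]) (simp add: n_def)
  then have "{..<m} - (+) s ` maya nu \<subseteq> {s - int n..<m}" by (auto simp flip: not_le)
  then show "finite ({..<m} - (+) s ` maya nu)" by (rule finite_subset) simp
qed

text \<open>The slope is even so that the triangular sums need no halving. Three choices of
  \<open>(\<alpha>, \<beta>)\<close> matter: \<open>(0, 1)\<close> gives the charge,
  \<open>(1, 1)\<close> the size of a self-conjugate partition, and \<open>(t, 2 * k + 1)\<close>
  the share of a runner in that size.\<close>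

lemma reg_sum_shifted_maya:
  assumes "is_partition nu"
  shows "reg_sum (\<lambda>i. 2 * \<alpha> * i + \<beta>) ((+) s ` maya nu) =
    2 * \<alpha> * int (sum_list nu) + \<alpha> * (s * (s - 1)) + \<beta> * s"
proof -
  \<comment> \<open>At least \<open>s\<close>, so that the cut-off \<open>s - int n\<close> is not
    positive; at least the length, so that the first \<open>n\<close> rows contain all
    parts.\<close>
  define n where "n = max (length nu) (nat s)"
  have len: "length nu \<le> n" and sn: "s \<le> int n" by (auto simp: n_def)
  let ?f = "\<lambda>i. 2 * \<alpha> * i + \<beta>"
  define k where "k = nat (int n - s)"
  have k: "int k = int n - s" using sn by (simp add: k_def)
  have gauss: "2 * (\<Sum>i = 1..m. int i) = int m * (int m + 1)" for m
    by (induction m) (auto simp: algebra_simps)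
  have "reg_sum ?f ((+) s ` maya nu) =
      (\<Sum>i\<in>(\<lambda>i. beta nu i + s) ` {1..n}. ?f i) - (\<Sum>i\<in>{s - int n..<0}. ?f i)"
    by (subst reg_sum_cutoff[of "s - int n"])
      (use sn maya_shift_tail[OF assms len, of s] finite_shifted_maya(1)[OF assms] in auto)
  also have "(\<Sum>i\<in>(\<lambda>i. beta nu i + s) ` {1..n}. ?f i) = (\<Sum>i = 1..n. ?f (beta nu i + s))"
    by (subst sum.reindex) (auto intro!: inj_onI beta_inj[OF assms])
  also have "\<dots> = (\<Sum>i = 1..n. 2 * \<alpha> * int (part_at nu i)) - \<alpha> * (2 * (\<Sum>i = 1..n. int i)) +
      int n * (2 * \<alpha> * s + \<beta>)"
    by (simp add: beta_def algebra_simps sum.distrib sum_subtractf sum_distrib_left)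
  also have "(\<Sum>i = 1..n. 2 * \<alpha> * int (part_at nu i)) = 2 * \<alpha> * int (sum_list nu)"
    using sum_part_at[OF len] by (simp flip: sum_distrib_left of_nat_sum)
  also have "(\<Sum>i\<in>{s - int n..<0}. ?f i) = (\<Sum>i = 1..k. ?f (- int i))"
    by (rule sum.reindex_bij_witness[of _ "\<lambda>i. - int i" "\<lambda>i. nat (- i)"]) (use k in auto)
  also have "\<dots> = int k * \<beta> - \<alpha> * (2 * (\<Sum>i = 1..k. int i))"
    by (simp add: algebra_simps sum.distrib sum_subtractf sum_distrib_left)
  finally show ?thesis unfolding gauss k by (simp add: algebra_simps)
qed

text \<open>The shift is the charge, which is read off from the set alone; after undoing it,
  \<open>maya_inj\<close> applies.\<close>

lemma shifted_maya_inj: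
  assumes "is_partition nu" "is_partition nu'" "(+) s ` maya nu = (+) s' ` maya nu'"
  shows "s = s'" "nu = nu'"
proof -
  show "s = s'"
    using reg_sum_shifted_maya[OF assms(1), of 0 1 s] reg_sum_shifted_maya[OF assms(2), of 0 1 s'] assms(3)
    by simp
  then have "maya nu = maya nu'" using assms(3) inj_image_eq_iff[of "(+) s'"] by simp
  then show "nu = nu'" by (rule maya_inj[OF assms(1,2)])
qed

text \<open>The elements are inserted in increasing order. A new maximum becomes the new first row;
  the old rows move down by one index while the cardinality grows by one, so their values stay the
  same.\<close>

lemma finite_set_as_betas:
  fixes S :: "int set"
  assumes "finite S" "S \<subseteq> {N..}"
  shows "\<exists>nu. is_partition nu \<and> length nu \<le> card S \<and>
    S = (\<lambda>i. beta nu i + int (card S) + N) ` {1..card S}"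
  using assms
proof (induction S rule: finite_linorder_max_induct)
  case empty
  then show ?case by (intro exI[of _ "[]"]) (simp add: is_partition_def)
next
  case (insert b A)
  then obtain nu where nu: "is_partition nu" "length nu \<le> card A"
    "A = (\<lambda>i. beta nu i + int (card A) + N) ` {1..card A}" by auto
  have "b \<notin> A" using insert by auto
  then have card: "card (insert b A) = Suc (card A)" using insert by simp
  define p where "p = nat (b - int (card A) - N)"
  have ge: "int (part_at nu 1) \<le> b - int (card A) - N"
  proof (cases "card A = 0")
    case True
    then show ?thesis using nu insert by (auto simp: part_at_def)
  next
    case False
    then have "beta nu 1 + int (card A) + N \<in> A" by (subst nu(3)) auto
    then show ?thesis using insert.hyps(2) by (force simp: beta_def)
  qed
  then have p: "int p = b - int (card A) - N" by (simp add: p_def)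
  \<comment> \<open>A zero part must not be stored; if \<open>p = 0\<close>, then \<open>nu\<close>
    has no parts either, as its largest part is at most \<open>p\<close>.\<close>
  define mu where "mu = (if p = 0 then [] else p # nu)"
  have zero: "nu = []" if "p = 0"
    using ge p that nu(1) part_at_pos_iff[OF nu(1), of 1] by (cases nu) auto
  have parts: "part_at mu (Suc i) = (if i = 0 then p else part_at nu i)" for i
    using zero by (auto simp: mu_def part_at_def nth_Cons')
  have "x \<le> p" if x: "x \<in> set nu" for x
  proof -
    obtain i where i: "i < length nu" "x = nu ! i" using x by (auto simp: in_set_conv_nth)
    then have "x = part_at nu (Suc i)" by (simp add: part_at_def)
    also have "\<dots> \<le> part_at nu 1" by (rule part_at_mono[OF nu(1)]) auto
    finally show ?thesis using ge p by linarith
  qed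
  then have "is_partition mu" using nu(1) by (auto simp: mu_def is_partition_def)
  moreover have "length mu \<le> card (insert b A)" using nu(2) by (simp add: mu_def card)
  moreover have "insert b A = (\<lambda>i. beta mu i + int (card (insert b A)) + N) ` {1..card (insert b A)}"
  proof -
    have "{1..Suc (card A)} = insert 1 (Suc ` {1..card A})"
      by (simp only: image_Suc_atLeastAtMost) auto
    then have "(\<lambda>i. beta mu i + int (Suc (card A)) + N) ` {1..Suc (card A)} =
        insert (beta mu 1 + int (Suc (card A)) + N)
          ((\<lambda>i. beta mu (Suc i) + int (Suc (card A)) + N) ` {1..card A})"
      by (simp only: image_insert image_image)
    also have "beta mu 1 + int (Suc (card A)) + N = b"
      using parts[of 0] p by (simp add: beta_def)
    also have "(\<lambda>i. beta mu (Suc i) + int (Suc (card A)) + N) ` {1..card A} =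
        (\<lambda>i. beta nu i + int (card A) + N) ` {1..card A}"
      by (rule image_cong) (auto simp: parts beta_def)
    finally show ?thesis using nu(3) by (simp add: card)
  qed
  ultimately show ?case by blast
qed

lemma shifted_maya_exists:
  assumes "finite (Z \<inter> {0..})" "finite ({..<0} - Z)"
  obtains nu s where "is_partition nu" "Z = (+) s ` maya nu"
proof -
  obtain N where N: "N \<le> 0" "{..<N} \<subseteq> Z"
  proof (cases "{..<0} - Z = {}")
    case True
    then show ?thesis using that[of 0] by auto
  next
    case False
    let ?N = "Min ({..<0} - Z)"
    have "?N \<in> {..<0} - Z" by (rule Min_in[OF assms(2) False])
    moreover have "{..<?N} \<subseteq> Z"
    proof
      fix x assume "x \<in> {..<?N}"
      then show "x \<in> Z" using Min_le[OF assms(2), of x] \<open>?N \<in> {..<0} - Z\<close> by force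
    qed
    ultimately show ?thesis using that[of ?N] by auto
  qed
  define S where "S = Z \<inter> {N..}"
  have "S \<subseteq> (Z \<inter> {0..}) \<union> {N..<0}" by (auto simp: S_def)
  then have "finite S" by (rule finite_subset) (use assms in auto)
  moreover have "S \<subseteq> {N..}" by (auto simp: S_def)
  ultimately obtain nu where nu: "is_partition nu" "length nu \<le> card S"
    "S = (\<lambda>i. beta nu i + int (card S) + N) ` {1..card S}"
    using finite_set_as_betas by blast
  \<comment> \<open>With this shift \<open>s - int (card S)\<close> is \<open>N\<close>, so that
    \<open>maya_shift_tail\<close> cuts at the point below which \<open>Z\<close> is full.\<close>
  define s where "s = int (card S) + N"
  have "x \<in> Z \<longleftrightarrow> x \<in> (+) s ` maya nu" for x
  proof (cases "x < N")
    case True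
    then show ?thesis
      using N(2) maya_shift_tail(2)[OF nu(1,2), of s] unfolding s_def by auto
  next
    case False
    then have "x \<in> Z \<longleftrightarrow> x \<in> S" by (simp add: S_def)
    also have "S = (+) s ` maya nu \<inter> {s - int (card S)..}"
      unfolding maya_shift_tail(1)[OF nu(1,2), of s]
      by (subst nu(3)) (simp add: s_def add.assoc)
    finally show ?thesis using False by (simp add: s_def)
  qed
  then show ?thesis using that nu(1) by blast
qed

definition charged_set :: "int set set" where
  "charged_set = {Z. finite (Z \<inter> {0..}) \<and> finite ({..<0} - Z)}"

text \<open>Charge and partition are independent coordinates on the Maya diagrams of arbitrary
  charge: the set-theoretic form of the boson-fermion correspondence.\<close>

lemma bij_betw_shifted_maya:
  "bij_betw (\<lambda>(s, nu). (+) s ` maya nu) (UNIV \<times> partitions) charged_set"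
  unfolding bij_betw_def
proof
  show "inj_on (\<lambda>(s, nu). (+) s ` maya nu) (UNIV \<times> partitions)"
    by (rule inj_onI) (auto simp: partitions_def dest: shifted_maya_inj)
  show "(\<lambda>(s, nu). (+) s ` maya nu) ` (UNIV \<times> partitions) = charged_set"
  proof (intro equalityI subsetI)
    fix Z :: "int set" assume "Z \<in> charged_set"
    then obtain nu s where "is_partition nu" and Z: "Z = (+) s ` maya nu"
      using shifted_maya_exists[of Z] unfolding charged_set_def by blast
    then have "(s, nu) \<in> UNIV \<times> partitions" by (simp add: partitions_def)
    from imageI[OF this, of "\<lambda>(s, nu). (+) s ` maya nu"]
    show "Z \<in> (\<lambda>(s, nu). (+) s ` maya nu) ` (UNIV \<times> partitions)" by (simp add: Z)
  qed (use finite_shifted_maya in \<open>auto simp: partitions_def charged_set_def\<close>)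
qed

section \<open>Self-conjugate partitions\<close>

text \<open>The only set of integers that has nonnegative part \<open>D\<close> and contains exactly
  one of \<open>m\<close> and \<open>-1 - m\<close> for every \<open>m\<close>.\<close>

definition sym_maya :: "nat set \<Rightarrow> int set" where
  "sym_maya D = {m. if 0 \<le> m then nat m \<in> D else nat (- 1 - m) \<notin> D}"

lemma sym_maya_reflect: "- 1 - m \<in> sym_maya D \<longleftrightarrow> m \<notin> sym_maya D"
  by (auto simp: sym_maya_def)

lemma sym_maya_nonneg: "sym_maya D \<inter> {0..} = int ` D"
proof (intro equalityI subsetI)
  fix m assume "m \<in> sym_maya D \<inter> {0..}"
  then have "nat m \<in> D" "int (nat m) = m" by (auto simp: sym_maya_def)
  then show "m \<in> int ` D" by (metis imageI)
qed (auto simp: sym_maya_def)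

lemma sym_maya_neg: "{..<0} - sym_maya D = (\<lambda>b. - 1 - int b) ` D"
proof (intro equalityI subsetI)
  fix m assume m: "m \<in> {..<0} - sym_maya D"
  then have "nat (- 1 - m) \<in> D" by (auto simp: sym_maya_def)
  then have "- 1 - int (nat (- 1 - m)) \<in> (\<lambda>b. - 1 - int b) ` D" by (rule imageI)
  then show "m \<in> (\<lambda>b. - 1 - int b) ` D" using m by simp
qed (auto simp: sym_maya_def)

lemma sym_maya_charged: "finite D \<Longrightarrow> sym_maya D \<in> charged_set"
  by (simp add: charged_set_def sym_maya_nonneg sym_maya_neg)

text \<open>A nonnegative beta number \<open>la_i - i\<close> is the arm length of the diagonal box
  in row \<open>i\<close>, so these are the Frobenius coordinates of a self-conjugate
  partition.\<close>

definition diagonal :: "nat list \<Rightarrow> nat set" where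
  "diagonal la = {b. int b \<in> maya la}"

lemma self_conjugates_iff:
  "la \<in> self_conjugates \<longleftrightarrow> is_partition la \<and> (\<forall>m. m \<in> maya la \<longleftrightarrow> - 1 - m \<notin> maya la)"
  using self_conjugate_iff[of la] by (auto simp: self_conjugates_def partitions_def)

lemma maya_eq_sym_maya:
  assumes "la \<in> self_conjugates"
  shows "maya la = sym_maya (diagonal la)"
proof (intro set_eqI)
  fix m
  have "m \<in> maya la \<longleftrightarrow> - 1 - m \<notin> maya la" using assms unfolding self_conjugates_iff by blast
  then show "m \<in> maya la \<longleftrightarrow> m \<in> sym_maya (diagonal la)"
    by (cases "0 \<le> m") (simp_all add: sym_maya_def diagonal_def)
qed

text \<open>Each \<open>b\<close> in \<open>D\<close> is accompanied by a gap at
  \<open>-1 - b\<close>. The constant \<open>\<beta>\<close> cancels between the two, so in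
  particular the charge is 0.\<close>

lemma reg_sum_sym_maya:
  assumes "finite D"
  shows "reg_sum (\<lambda>i. 2 * \<alpha> * i + \<beta>) (sym_maya D) = 2 * \<alpha> * int (\<Sum>b\<in>D. 2 * b + 1)"
proof -
  have "reg_sum (\<lambda>i. 2 * \<alpha> * i + \<beta>) (sym_maya D) =
      (\<Sum>b\<in>D. 2 * \<alpha> * int b + \<beta>) - (\<Sum>b\<in>D. 2 * \<alpha> * (- 1 - int b) + \<beta>)"
    by (simp add: reg_sum_def sym_maya_nonneg sym_maya_neg sum.reindex inj_on_def)
  also have "\<dots> = (\<Sum>b\<in>D. (2 * \<alpha> * int b + \<beta>) - (2 * \<alpha> * (- 1 - int b) + \<beta>))"
    by (simp only: sum_subtractf)
  also have "\<dots> = (\<Sum>b\<in>D. 2 * \<alpha> * (2 * int b + 1))"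
    by (rule sum.cong) (auto simp: algebra_simps)
  finally show ?thesis by (simp add: sum_distrib_left add.commute)
qed

lemma bij_betw_diagonal: "bij_betw diagonal self_conjugates {D. finite D}"
  unfolding bij_betw_def
proof
  show "inj_on diagonal self_conjugates"
    by (rule inj_onI, rule maya_inj)
      (auto simp: maya_eq_sym_maya self_conjugates_def partitions_def)
  show "diagonal ` self_conjugates = {D. finite D}"
  proof (intro equalityI subsetI)
    fix D assume "D \<in> diagonal ` self_conjugates"
    then obtain la where la: "la \<in> self_conjugates" "D = diagonal la" by auto
    then have "finite (maya la \<inter> {0..})"
      using finite_shifted_maya(1)[of la 0 0] by (simp add: self_conjugates_def partitions_def)
    moreover have "int ` D \<subseteq> maya la \<inter> {0..}" by (auto simp: la diagonal_def)
    ultimately have "finite (int ` D)" using finite_subset by blast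
    then show "D \<in> {D. finite D}" by (simp add: finite_image_iff)
  next
    fix D :: "nat set" assume "D \<in> {D. finite D}"
    then have fin: "finite D" by simp
    have "sym_maya D \<in> charged_set" by (rule sym_maya_charged[OF fin])
    then obtain nu s where nu: "is_partition nu" "sym_maya D = (+) s ` maya nu"
      using shifted_maya_exists[of "sym_maya D"] unfolding charged_set_def by blast
    \<comment> \<open>Symmetry forces charge 0, so the set is the unshifted Maya diagram of a
      partition.\<close>
    have "s = 0"
      using reg_sum_sym_maya[OF fin, of 0 1] reg_sum_shifted_maya[OF nu(1), of 0 1 s]
      by (simp add: nu(2))
    then have maya: "maya nu = sym_maya D" using nu(2) by simp
    have "nu \<in> self_conjugates"
      unfolding self_conjugates_iff maya using nu(1) sym_maya_reflect by blast
    moreover have "D = diagonal nu" by (simp add: diagonal_def maya sym_maya_def)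
    ultimately show "D \<in> diagonal ` self_conjugates" by blast
  qed
qed

lemma finite_diagonal: "la \<in> self_conjugates \<Longrightarrow> finite (diagonal la)"
  using bij_betw_diagonal by (auto simp: bij_betw_def)

text \<open>The renormalised sum of \<open>2 * i + 1\<close> over the zeros is evaluated once from
  the rows and once from the symmetry.\<close>

lemma sum_list_self_conjugate:
  assumes "la \<in> self_conjugates"
  shows "sum_list la = (\<Sum>b\<in>diagonal la. 2 * b + 1)"
proof -
  have "is_partition la" using assms by (simp add: self_conjugates_def partitions_def)
  then have "int (sum_list la) = int (\<Sum>b\<in>diagonal la. 2 * b + 1)"
    using reg_sum_sym_maya[OF finite_diagonal[OF assms], of 1 1]
      reg_sum_shifted_maya[of la 1 1 0] maya_eq_sym_maya[OF assms] by simp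
  then show ?thesis by (simp only: of_nat_eq_iff)
qed

section \<open>Runners\<close>

definition runner :: "nat \<Rightarrow> nat \<Rightarrow> nat set \<Rightarrow> int set" where
  "runner t k D = {i. int t * i + int k \<in> sym_maya D}"

text \<open>The residue class to which the reflection \<open>m \<mapsto> -1 - m\<close> carries the
  class of \<open>k\<close>.\<close>

definition mirror :: "nat \<Rightarrow> nat \<Rightarrow> nat" where
  "mirror t k = t - 1 - k"

lemma mirror_less [simp]: "k < t \<Longrightarrow> mirror t k < t"
  by (simp add: mirror_def)

lemma int_mirror: "k < t \<Longrightarrow> int (mirror t k) = int t - 1 - int k"
  by (auto simp: mirror_def)

text \<open>The elements of \<open>D\<close> on which runner \<open>k\<close> depends: residue
  \<open>k\<close> gives its nonnegative positions, the mirrored residue gives by reflection its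
  negative ones.\<close>

definition runner_boxes :: "nat \<Rightarrow> nat \<Rightarrow> nat set" where
  "runner_boxes t k = {b. b mod t = k \<or> b mod t = mirror t k}"

text \<open>The inverse of \<open>runner t k\<close> on subsets of \<open>runner_boxes t k\<close>
  when \<open>k\<close> is not the middle residue: nonnegative elements of \<open>Z\<close> are
  kept, and negative gaps are reflected into the mirrored class.\<close>

definition runner_union :: "nat \<Rightarrow> int set \<Rightarrow> nat \<Rightarrow> nat set" where
  "runner_union t Z k =
    {b. b mod t = k \<and> int (b div t) \<in> Z \<or> b mod t = mirror t k \<and> - 1 - int (b div t) \<notin> Z}"

lemma nat_runner_pos:
  assumes "k < t" "0 \<le> i"
  shows "int t * i + int k = int (t * nat i + k)"
  using assms by simp

lemma nat_runner_neg:
  assumes "k < t" "i < 0"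
  shows "- 1 - (int t * i + int k) = int (t * nat (- 1 - i) + mirror t k)" "int t * i + int k < 0"
proof -
  note int_mirror[OF assms(1)]
  moreover have "int t * i \<le> int t * (- 1)" using assms by (intro mult_left_mono) auto
  ultimately show "- 1 - (int t * i + int k) = int (t * nat (- 1 - i) + mirror t k)"
    "int t * i + int k < 0"
    using assms by (auto simp: algebra_simps)
qed

lemma mem_runner_nonneg:
  assumes "k < t" "0 \<le> i"
  shows "i \<in> runner t k D \<longleftrightarrow> t * nat i + k \<in> D"
  unfolding runner_def mem_Collect_eq nat_runner_pos[OF assms] by (simp add: sym_maya_def nat_int del: of_nat_add of_nat_mult)

lemma mem_runner_neg:
  assumes "k < t" "i < 0"
  shows "i \<in> runner t k D \<longleftrightarrow> t * nat (- 1 - i) + mirror t k \<notin> D"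
  using nat_runner_neg[OF assms] by (simp add: runner_def sym_maya_def del: of_nat_add of_nat_mult)

lemma runner_restrict:
  assumes "k < t"
  shows "runner t k (D \<inter> runner_boxes t k) = runner t k D"
proof (intro set_eqI)
  fix i show "i \<in> runner t k (D \<inter> runner_boxes t k) \<longleftrightarrow> i \<in> runner t k D"
    using assms by (cases "0 \<le> i")
      (auto simp: mem_runner_nonneg mem_runner_neg not_le runner_boxes_def)
qed

lemma runner_runner_union:
  assumes "k < t" "k \<noteq> mirror t k"
  shows "runner t k (runner_union t Z k) = Z"
proof (intro set_eqI)
  fix i show "i \<in> runner t k (runner_union t Z k) \<longleftrightarrow> i \<in> Z"
    using assms by (cases "0 \<le> i")
      (auto simp: mem_runner_nonneg mem_runner_neg not_le runner_union_def)
qed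

lemma runner_union_runner:
  assumes "k < t" "k \<noteq> mirror t k" "D \<subseteq> runner_boxes t k"
  shows "runner_union t (runner t k D) k = D"
proof (intro set_eqI)
  fix b
  have b: "t * (b div t) + b mod t = b" by simp
  consider "b mod t = k" | "b mod t = mirror t k" | "b \<notin> runner_boxes t k"
    by (auto simp: runner_boxes_def)
  then show "b \<in> runner_union t (runner t k D) k \<longleftrightarrow> b \<in> D"
  proof cases
    case 1
    then show ?thesis
      using assms b by (auto simp: runner_union_def mem_runner_nonneg)
  next
    case 2
    then show ?thesis
      using assms b by (auto simp: runner_union_def mem_runner_neg)
  next
    case 3
    then show ?thesis using assms(3) by (auto simp: runner_union_def runner_boxes_def)
  qed
qed

lemma runner_charged:
  assumes "k < t" "finite D"
  shows "runner t k D \<in> charged_set"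
proof -
  have "inj_on (\<lambda>i. t * nat i + k) (runner t k D \<inter> {0..})"
    using assms(1) by (intro inj_onI) auto
  moreover have "(\<lambda>i. t * nat i + k) ` (runner t k D \<inter> {0..}) \<subseteq> D"
    using assms(1) by (auto simp: mem_runner_nonneg)
  ultimately have "finite (runner t k D \<inter> {0..})"
    using assms(2) by (metis finite_imageD finite_subset)
  moreover
  have "inj_on (\<lambda>i. t * nat (- 1 - i) + mirror t k) ({..<0} - runner t k D)"
    using assms(1) by (intro inj_onI) auto
  moreover have "(\<lambda>i. t * nat (- 1 - i) + mirror t k) ` ({..<0} - runner t k D) \<subseteq> D"
    using assms(1) by (auto simp: mem_runner_neg)
  ultimately show ?thesis
    using assms(2) unfolding charged_set_def mem_Collect_eq by (metis finite_imageD finite_subset)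
qed

lemma runner_union_eq:
  assumes "k < t"
  shows "runner_union t Z k = (\<lambda>i. t * nat i + k) ` (Z \<inter> {0..}) \<union>
    (\<lambda>i. t * nat (- 1 - i) + mirror t k) ` ({..<0} - Z)" (is "_ = ?A \<union> ?B")
proof (intro equalityI subsetI)
  fix b assume "b \<in> runner_union t Z k"
  then consider "b mod t = k" "int (b div t) \<in> Z" | "b mod t = mirror t k" "- 1 - int (b div t) \<notin> Z"
    by (auto simp: runner_union_def)
  then show "b \<in> ?A \<union> ?B"
  proof cases
    case 1
    have "t * nat (int (b div t)) + k \<in> ?A" by (rule imageI) (use 1 in auto)
    moreover have "t * nat (int (b div t)) + k = b" unfolding 1(1)[symmetric] by simp
    ultimately show ?thesis by simp
  next
    case 2
    have "t * nat (- 1 - (- 1 - int (b div t))) + mirror t k \<in> ?B" by (rule imageI) (use 2 in auto)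
    moreover have "t * nat (- 1 - (- 1 - int (b div t))) + mirror t k = b"
      unfolding 2(1)[symmetric] by simp
    ultimately show ?thesis by simp
  qed
qed (use assms in \<open>auto simp: runner_union_def\<close>)

lemma runner_union_subset: "runner_union t Z k \<subseteq> runner_boxes t k"
  by (auto simp: runner_union_def runner_boxes_def)

lemma finite_runner_union:
  assumes "k < t" "Z \<in> charged_set"
  shows "finite (runner_union t Z k)"
  using assms by (simp add: runner_union_eq charged_set_def)

text \<open>A negative gap \<open>i\<close> yields the element \<open>b = -1 - (t * i + k)\<close>,
  for which \<open>2 * b + 1\<close> is minus the value of the summand at \<open>i\<close>. The
  total is therefore a renormalised sum.\<close>

lemma sum_runner_union:
  assumes "k < t" "k \<noteq> mirror t k" "Z \<in> charged_set"
  shows "int (\<Sum>b\<in>runner_union t Z k. 2 * b + 1) = reg_sum (\<lambda>i. 2 * int t * i + (2 * int k + 1)) Z"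
proof -
  let ?p = "\<lambda>i. t * nat i + k" and ?n = "\<lambda>i. t * nat (- 1 - i) + mirror t k"
  have fin: "finite (Z \<inter> {0..})" "finite ({..<0} - Z)" using assms(3) by (auto simp: charged_set_def)
  have "?p i \<noteq> ?n j" for i j
  proof
    assume "?p i = ?n j"
    then have "?p i mod t = ?n j mod t" by (rule arg_cong)
    then show False using assms(1,2) by simp
  qed
  then have "?p ` (Z \<inter> {0..}) \<inter> ?n ` ({..<0} - Z) = {}" by blast
  then have "(\<Sum>b\<in>runner_union t Z k. 2 * int b + 1) =
      (\<Sum>b\<in>?p ` (Z \<inter> {0..}). 2 * int b + 1) + (\<Sum>b\<in>?n ` ({..<0} - Z). 2 * int b + 1)"
    unfolding runner_union_eq[OF assms(1)] using fin by (intro sum.union_disjoint) auto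
  also have "(\<Sum>b\<in>?p ` (Z \<inter> {0..}). 2 * int b + 1) = (\<Sum>i\<in>Z \<inter> {0..}. 2 * int t * i + (2 * int k + 1))"
    using assms(1) by (subst sum.reindex) (auto intro!: inj_onI sum.cong simp: algebra_simps)
  also have "(\<Sum>b\<in>?n ` ({..<0} - Z). 2 * int b + 1) = (\<Sum>i\<in>{..<0} - Z. 2 * int (?n i) + 1)"
    using assms(1) by (subst sum.reindex) (auto intro!: inj_onI)
  also have "\<dots> = (\<Sum>i\<in>{..<0} - Z. - (2 * int t * i + (2 * int k + 1)))"
    by (rule sum.cong[OF refl], subst nat_runner_neg(1)[OF assms(1), symmetric]) auto
  also have "\<dots> = - (\<Sum>i\<in>{..<0} - Z. 2 * int t * i + (2 * int k + 1))"
    by (rule sum_negf)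
  finally show ?thesis by (simp add: reg_sum_def add.commute[of 1])
qed

definition runner_partition :: "nat \<Rightarrow> nat \<Rightarrow> int \<times> nat list \<Rightarrow> nat set" where
  "runner_partition t k = (\<lambda>(s, nu). runner_union t ((+) s ` maya nu) k)"

lemma shifted_maya_charged: "is_partition nu \<Longrightarrow> (+) s ` maya nu \<in> charged_set"
  unfolding charged_set_def using finite_shifted_maya(1)[of nu s 0] finite_shifted_maya(2)[of nu 0 s]
  by blast

lemma bij_betw_runner_partition:
  assumes "k < t" "k \<noteq> mirror t k"
  shows "bij_betw (runner_partition t k) (UNIV \<times> partitions) {D. finite D \<and> D \<subseteq> runner_boxes t k}"
proof -
  have "bij_betw (\<lambda>Z. runner_union t Z k) charged_set {D. finite D \<and> D \<subseteq> runner_boxes t k}"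
    by (rule bij_betw_byWitness[of _ "runner t k"])
      (use assms runner_charged finite_runner_union
        in \<open>auto simp: runner_runner_union runner_union_runner intro: runner_union_subset[THEN subsetD]\<close>)
  from bij_betw_trans[OF bij_betw_shifted_maya this] show ?thesis
    by (simp add: runner_partition_def comp_def case_prod_unfold)
qed

lemma runner_runner_partition:
  "k < t \<Longrightarrow> k \<noteq> mirror t k \<Longrightarrow> runner t k (runner_partition t k (s, nu)) = (+) s ` maya nu"
  by (simp add: runner_partition_def runner_runner_union)

text \<open>The size contributed by a runner of charge \<open>s\<close> whose partition is empty.
  For \<open>k < t\<close> the conversion \<open>nat\<close> loses nothing, by
  \<open>charge_energy_ge\<close>.\<close>

definition charge_energy :: "nat \<Rightarrow> nat \<Rightarrow> int \<Rightarrow> nat" where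
  "charge_energy t k s = nat (int t * (s * (s - 1)) + (2 * int k + 1) * s)"

text \<open>The bound serves twice: it makes the energy nonnegative, and it leaves only finitely
  many charges of a given energy.\<close>

lemma charge_energy_ge:
  assumes "k < t"
  shows "\<bar>s\<bar> \<le> int t * (s * (s - 1)) + (2 * int k + 1) * s"
proof (cases "s \<le> 0")
  case True
  have nonneg: "0 \<le> int t * (- s)" using True by (intro mult_nonneg_nonneg) auto
  \<comment> \<open>For negative \<open>s\<close> the quadratic term is at least
    \<open>2 * t * (- s)\<close> and exceeds this linear bound by at least
    \<open>- s\<close>.\<close>
  have "(2 * int k + 1) * (- s) \<le> (2 * int t - 1) * (- s)"
    using assms True by (intro mult_right_mono) auto
  moreover have "2 * int t * (- s) \<le> int t * (- s) * (1 - s)" if "s \<noteq> 0"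
    using that True mult_left_mono[OF _ nonneg, of 2 "1 - s"] by simp
  ultimately show ?thesis using True by (cases "s = 0") (auto simp: algebra_simps)
next
  case False
  then have "0 \<le> int t * (s * (s - 1))" by simp
  moreover have "s \<le> (2 * int k + 1) * s" using False by (simp add: algebra_simps)
  ultimately show ?thesis using False by linarith
qed

lemma sum_runner_partition:
  assumes "k < t" "k \<noteq> mirror t k" "is_partition nu"
  shows "(\<Sum>b\<in>runner_partition t k (s, nu). 2 * b + 1) = charge_energy t k s + 2 * t * sum_list nu"
proof -
  have "int (\<Sum>b\<in>runner_partition t k (s, nu). 2 * b + 1) =
      2 * int t * int (sum_list nu) + int t * (s * (s - 1)) + (2 * int k + 1) * s"
    unfolding runner_partition_def prod.case
      sum_runner_union[OF assms(1,2) shifted_maya_charged[OF assms(3)]]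
    by (rule reg_sum_shifted_maya[OF assms(3)])
  also have "\<dots> = int (charge_energy t k s + 2 * t * sum_list nu)"
    using charge_energy_ge[OF assms(1), of s] by (simp add: charge_energy_def)
  finally show ?thesis by (simp only: of_nat_eq_iff)
qed

lemma finite_charge_energy:
  assumes "k < t"
  shows "finite {s. charge_energy t k s = n}"
proof (rule finite_subset)
  show "{s. charge_energy t k s = n} \<subseteq> {- int n..int n}"
  proof
    fix s assume "s \<in> {s. charge_energy t k s = n}"
    then show "s \<in> {- int n..int n}"
      using charge_energy_ge[OF assms, of s] by (auto simp: charge_energy_def)
  qed
qed simp

section \<open>The quotient and the middle runner of a partition in \<open>BG\<close>\<close>

lemma word_eq_maya:
  assumes "is_partition la"
  shows "word la m = (if m \<in> maya la then 0 else 1)"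
  by (auto simp: word_eq[OF assms] maya_iff beta_def)

lemma mem_shift_iff: "x \<in> (+) s ` Z \<longleftrightarrow> x - s \<in> Z" for x :: int
proof
  assume "x - s \<in> Z"
  then have "s + (x - s) \<in> (+) s ` Z" by (rule imageI)
  then show "x \<in> (+) s ` Z" by simp
qed auto

text \<open>Shifting the index of a word translates its set of zeros, so the defining condition of
  the quotient is an equation between shifted Maya diagrams, and \<open>shifted_maya_inj\<close>
  gives uniqueness.\<close>

lemma t_quotient_eq:
  assumes "is_partition la" "is_partition nu"
    and runner: "{i. int t * i + int k \<in> maya la} = (+) s ` maya nu"
  shows "t_quotient t la k = nu"
proof -
  have *: "(\<forall>i. word mu (i + r) = word la (int t * i + int k)) \<longleftrightarrow> (+) (- r) ` maya mu = (+) s ` maya nu"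
    if "is_partition mu" for mu r
  proof -
    have "(\<forall>i. word mu (i + r) = word la (int t * i + int k)) \<longleftrightarrow>
        (\<forall>i. i + r \<in> maya mu \<longleftrightarrow> int t * i + int k \<in> maya la)"
      by (auto simp: word_eq_maya[OF that] word_eq_maya[OF assms(1)] split: if_splits)
    also have "\<dots> \<longleftrightarrow> {i. i + r \<in> maya mu} = {i. int t * i + int k \<in> maya la}" by blast
    also have "{i. i + r \<in> maya mu} = (+) (- r) ` maya mu"
      by (intro set_eqI) (simp only: mem_shift_iff mem_Collect_eq diff_minus_eq_add)
    finally show ?thesis unfolding runner .
  qed
  show ?thesis
    unfolding t_quotient_def
  proof (rule the_equality)
    have "\<forall>i. word nu (i + - s) = word la (int t * i + int k)"
      unfolding *[OF assms(2)] by simp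
    then show "nu \<in> partitions \<and> (\<exists>r. \<forall>i. word nu (i + r) = word la (int t * i + int k))"
      using assms(2) unfolding partitions_def by blast
    fix mu assume "mu \<in> partitions \<and> (\<exists>r. \<forall>i. word mu (i + r) = word la (int t * i + int k))"
    then obtain r where "is_partition mu" "(+) (- r) ` maya mu = (+) s ` maya nu"
      using * unfolding partitions_def by blast
    then show "mu = nu" using shifted_maya_inj(2) assms(2) by blast
  qed
qed

lemma runner_middle_empty:
  assumes "k < t" "mirror t k = k" "D \<inter> runner_boxes t k = {}"
  shows "runner t k D = {..<0}"
proof -
  have "i \<in> runner t k D \<longleftrightarrow> i < 0" for i
  proof (cases "0 \<le> i")
    case True
    have "t * nat i + k \<in> runner_boxes t k" using assms by (simp add: runner_boxes_def)
    then show ?thesis using assms True by (auto simp: mem_runner_nonneg)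
  next
    case False
    have "t * nat (- 1 - i) + k \<in> runner_boxes t k" using assms by (simp add: runner_boxes_def)
    then show ?thesis using assms False by (auto simp: mem_runner_neg)
  qed
  then show ?thesis by auto
qed

text \<open>For the middle residue \<open>t = 2 * k + 1\<close>, so reflecting the integers reflects
  the indices of the runner.\<close>

lemma runner_reflect:
  assumes "k < t" "mirror t k = k"
  shows "- 1 - i \<in> runner t k D \<longleftrightarrow> i \<notin> runner t k D"
proof -
  have "int t = 2 * int k + 1" using int_mirror[OF assms(1)] assms(2) by simp
  then have "int t * (- 1 - i) + int k = - 1 - (int t * i + int k)" by (simp add: algebra_simps)
  then show ?thesis unfolding runner_def mem_Collect_eq by (simp only: sym_maya_reflect)
qed

text \<open>An empty quotient component says only that the middle runner is some half-line. Its
  symmetry places the end at 0, and then \<open>D\<close> has no element of the middle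
  residue.\<close>

lemma BG_iff:
  assumes "odd t"
  shows "la \<in> BG t \<longleftrightarrow> la \<in> self_conjugates \<and> diagonal la \<inter> runner_boxes t ((t - 1) div 2) = {}"
proof (cases "la \<in> self_conjugates")
  case True
  define k where "k = (t - 1) div 2"
  have k: "k < t" "mirror t k = k" using assms by (auto simp: k_def mirror_def elim!: oddE)
  have part: "is_partition la" using True by (simp add: self_conjugates_def partitions_def)
  have nil: "is_partition []" by (simp add: is_partition_def)
  have runner: "{i. int t * i + int k \<in> maya la} = runner t k (diagonal la)"
    by (simp add: runner_def maya_eq_sym_maya[OF True])
  have "t_quotient t la k = [] \<longleftrightarrow> diagonal la \<inter> runner_boxes t k = {}"
  proof
    assume "t_quotient t la k = []"
    moreover obtain nu s where nu: "is_partition nu" "runner t k (diagonal la) = (+) s ` maya nu"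
      using shifted_maya_exists runner_charged[OF k(1) finite_diagonal[OF True]]
      unfolding charged_set_def by blast
    ultimately have "nu = []" using t_quotient_eq[OF part nu(1)] runner by metis
    then have R: "i \<in> runner t k (diagonal la) \<longleftrightarrow> i < s" for i
      using nu(2) by (simp add: maya_Nil mem_shift_iff)
    \<comment> \<open>Reflecting the first gap \<open>s\<close> gives \<open>s >= 0\<close>;
      reflecting the last element \<open>s - 1\<close> gives \<open>s <= 0\<close>.\<close>
    have "s = 0" using runner_reflect[OF k, of s "diagonal la"] runner_reflect[OF k, of "s - 1" "diagonal la"] R
      by simp
    show "diagonal la \<inter> runner_boxes t k = {}"
    proof (rule ccontr)
      assume "diagonal la \<inter> runner_boxes t k \<noteq> {}"
      then obtain b where b: "b \<in> diagonal la" "b mod t = k" using k(2) by (auto simp: runner_boxes_def)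
      have "t * (b div t) + k = b" unfolding b(2)[symmetric] by simp
      then have "int (b div t) \<in> runner t k (diagonal la)"
        using b(1) k(1) by (simp add: mem_runner_nonneg)
      then show False using R \<open>s = 0\<close> by simp
    qed
  next
    assume "diagonal la \<inter> runner_boxes t k = {}"
    then have "runner t k (diagonal la) = (+) 0 ` maya []"
      using runner_middle_empty[OF k] by (simp add: maya_Nil)
    then show "t_quotient t la k = []" using t_quotient_eq[OF part nil, of t k 0] runner by simp
  qed
  then show ?thesis using True by (simp add: BG_def k_def)
qed (simp add: BG_def)

section \<open>Hooks divisible by \<open>t\<close> and the signs of their boxes\<close>

definition div_inversions :: "nat \<Rightarrow> int set \<Rightarrow> (int \<times> int) set" where
  "div_inversions t Z = {(a, b) \<in> inversions Z. int t dvd b - a}"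

lemma finite_inversions_charged:
  assumes "Z \<in> charged_set"
  shows "finite (inversions Z)"
proof -
  obtain nu s where nu: "is_partition nu" "Z = (+) s ` maya nu"
    using shifted_maya_exists assms unfolding charged_set_def by blast
  show ?thesis
    using bij_betw_finite[OF bij_betw_inversions_shift[of s "maya nu"]] finite_inversions[OF nu(1)] nu(2)
    by simp
qed

text \<open>Divisibility of \<open>b - a\<close> puts both ends into one residue class; dividing by
  \<open>t\<close> turns the pair into an inversion of that runner.\<close>

lemma div_inversions_residue:
  assumes "k < t"
  shows "{(a, b) \<in> div_inversions t (sym_maya D). a mod int t = int k} =
    (\<lambda>(i, j). (int t * i + int k, int t * j + int k)) ` inversions (runner t k D)"
proof (intro equalityI subsetI)
  fix p assume "p \<in> {(a, b) \<in> div_inversions t (sym_maya D). a mod int t = int k}"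
  then obtain a b where p: "p = (a, b)" "a \<notin> sym_maya D" "b \<in> sym_maya D" "a < b"
    "int t dvd b - a" "a mod int t = int k"
    by (auto simp: div_inversions_def inversions_def)
  have "b mod int t = int k" using p(5,6) by (metis mod_eq_dvd_iff)
  then have ab: "a = int t * (a div int t) + int k" "b = int t * (b div int t) + int k"
    using p(6) by (metis mult_div_mod_eq)+
  then have "int t * (a div int t) < int t * (b div int t)" using p(4) by linarith
  then have "a div int t < b div int t" by (simp add: mult_less_cancel_left)
  then have "(a div int t, b div int t) \<in> inversions (runner t k D)"
    using p(2,3) ab by (simp add: inversions_def runner_def)
  from imageI[OF this, of "\<lambda>(i, j). (int t * i + int k, int t * j + int k)"]
  show "p \<in> (\<lambda>(i, j). (int t * i + int k, int t * j + int k)) ` inversions (runner t k D)"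
    using ab p(1) by simp
next
  fix p assume "p \<in> (\<lambda>(i, j). (int t * i + int k, int t * j + int k)) ` inversions (runner t k D)"
  then show "p \<in> {(a, b) \<in> div_inversions t (sym_maya D). a mod int t = int k}"
    using assms by (auto simp: div_inversions_def inversions_def runner_def simp flip: right_diff_distrib)
qed

lemma mod_reflect:
  fixes a n :: int
  assumes "0 < n"
  shows "(- 1 - a) mod n = n - 1 - a mod n"
proof -
  have "- 1 - a - (n - 1 - a mod n) = n * (- (a div n) - 1)"
    by (simp add: minus_mult_div_eq_mod[symmetric] algebra_simps)
  then have "(- 1 - a) mod n = (n - 1 - a mod n) mod n"
    by (simp add: mod_eq_dvd_iff)
  also have "\<dots> = n - 1 - a mod n"
    using assms pos_mod_sign[of n a] pos_mod_bound[of n a] by (intro mod_pos_pos_trivial) linarith+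
  finally show ?thesis .
qed

text \<open>The involution \<open>\<sigma>\<close> preserves these inversions and sends residue
  \<open>r\<close> to \<open>t - 1 - r\<close>. The middle runner is a half-line and has no
  inversions, so every orbit has exactly one member in a residue below the middle.\<close>

lemma div_inversions_split:
  assumes "odd t" "D \<inter> runner_boxes t ((t - 1) div 2) = {}"
  defines "L \<equiv> {(a, b) \<in> div_inversions t (sym_maya D). a mod int t < int ((t - 1) div 2)}"
    and "\<sigma> \<equiv> \<lambda>(a, b). (- 1 - b, - 1 - a)"
  shows "div_inversions t (sym_maya D) = L \<union> \<sigma> ` L" "L \<inter> \<sigma> ` L = {}" "inj_on \<sigma> L"
proof -
  define m where "m = (t - 1) div 2"
  have t: "int t = 2 * int m + 1" "m < t" "mirror t m = m"
    using assms(1) by (auto simp: m_def mirror_def elim!: oddE)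
  let ?T = "div_inversions t (sym_maya D)"
  have inv: "\<sigma> p \<in> ?T" if "p \<in> ?T" for p
    using that by (cases p) (simp add: \<sigma>_def div_inversions_def inversions_def sym_maya_reflect)
  have \<sigma>\<sigma>: "\<sigma> (\<sigma> p) = p" for p by (auto simp: \<sigma>_def split: prod.splits)
  have mod: "fst (\<sigma> p) mod int t = int t - 1 - fst p mod int t" if p: "p \<in> ?T" for p
  proof -
    obtain a b where ab: "p = (a, b)" "int t dvd b - a" using p by (auto simp: div_inversions_def)
    then have "b mod int t = a mod int t" by (simp add: mod_eq_dvd_iff)
    then show ?thesis using t ab mod_reflect[of "int t" b] by (simp add: \<sigma>_def)
  qed
  have middle: "fst p mod int t \<noteq> int m" if p: "p \<in> ?T" for p
  proof
    assume "fst p mod int t = int m"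
    then have "p \<in> {(a, b) \<in> ?T. a mod int t = int m}" using p by auto
    then have "inversions (runner t m D) \<noteq> {}" unfolding div_inversions_residue[OF t(2)] by blast
    then show False
      using runner_middle_empty[OF t(2,3)] assms(2) by (auto simp: inversions_def m_def)
  qed
  have L: "p \<in> L \<longleftrightarrow> p \<in> ?T \<and> fst p mod int t < int m" for p by (auto simp: L_def m_def)
  show "L \<inter> \<sigma> ` L = {}" using mod t by (auto simp: L)
  show "inj_on \<sigma> L" by (rule inj_onI) (metis \<sigma>\<sigma>)
  show "?T = L \<union> \<sigma> ` L"
  proof (intro equalityI subsetI)
    fix p assume p: "p \<in> ?T"
    show "p \<in> L \<union> \<sigma> ` L"
    proof (cases "fst p mod int t < int m")
      case False
      then have "\<sigma> p \<in> L" using inv[OF p] mod[OF p] middle[OF p] t by (simp add: L)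
      then have "\<sigma> (\<sigma> p) \<in> \<sigma> ` L" by (rule imageI)
      then show ?thesis by (simp add: \<sigma>\<sigma>)
    qed (use p in \<open>simp add: L\<close>)
  qed (use inv L in auto)
qed

text \<open>Working in \<open>comm_monoid_set\<close> covers the product over \<open>rho1\<close>,
  the sum over \<open>rho2\<close> and the count of hooks at once.\<close>

lemma (in comm_monoid_set) div_inversions_runners:
  assumes "odd t" "finite D" "D \<inter> runner_boxes t ((t - 1) div 2) = {}"
  shows "F \<phi> (div_inversions t (sym_maya D)) =
    F (\<lambda>k. F (\<lambda>(i, j). f (\<phi> (int t * i + int k, int t * j + int k))
                        (\<phi> (- 1 - (int t * j + int k), - 1 - (int t * i + int k))))
           (inversions (runner t k D))) {..<(t - 1) div 2}"
proof -
  define m where "m = (t - 1) div 2"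
  have t: "0 < t" "m < t" using assms(1) by (auto simp: m_def elim!: oddE)
  let ?T = "div_inversions t (sym_maya D)"
  define \<sigma> :: "int \<times> int \<Rightarrow> int \<times> int" where "\<sigma> = (\<lambda>(a, b). (- 1 - b, - 1 - a))"
  define L where "L = {(a, b) \<in> ?T. a mod int t < int m}"
  note split = div_inversions_split[OF assms(1,3), folded m_def, folded L_def \<sigma>_def]
  define e where "e k = (\<lambda>(i, j). (int t * i + int k, int t * j + int k))" for k :: nat
  have "?T \<subseteq> inversions (sym_maya D)" by (auto simp: div_inversions_def)
  then have finT: "finite ?T"
    by (rule finite_subset) (rule finite_inversions_charged[OF sym_maya_charged[OF assms(2)]])
  then have finL: "finite L" by (rule finite_subset[rotated]) (auto simp: L_def)
  have res: "{p \<in> ?T. fst p mod int t = int k} = e k ` inversions (runner t k D)" if "k < m" for k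
    using div_inversions_residue[of k t D] that t by (simp add: e_def case_prod_unfold)
  have L: "L = (\<Union>k<m. e k ` inversions (runner t k D))"
  proof (intro equalityI subsetI)
    fix p assume "p \<in> L"
    then have p: "p \<in> ?T" "fst p mod int t < int m" by (auto simp: L_def)
    define k where "k = nat (fst p mod int t)"
    have k: "fst p mod int t = int k" using t by (simp add: k_def)
    then have "k < m" using p by simp
    then show "p \<in> (\<Union>k<m. e k ` inversions (runner t k D))"
      using res[of k] k p(1) by blast
  next
    fix p assume "p \<in> (\<Union>k<m. e k ` inversions (runner t k D))"
    then obtain k where k: "k < m" "p \<in> {p \<in> ?T. fst p mod int t = int k}" using res by blast
    then show "p \<in> L" by (auto simp: L_def)
  qed
  have "F \<phi> ?T = f (F \<phi> L) (F \<phi> (\<sigma> ` L))"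
    using split finL by (simp add: union_disjoint)
  also have "F \<phi> (\<sigma> ` L) = F (\<lambda>p. \<phi> (\<sigma> p)) L"
    using split(3) by (simp add: reindex)
  also have "f (F \<phi> L) (F (\<lambda>p. \<phi> (\<sigma> p)) L) = F (\<lambda>p. f (\<phi> p) (\<phi> (\<sigma> p))) L"
    by (simp add: distrib)
  also have "\<dots> = F (\<lambda>k. F (\<lambda>p. f (\<phi> p) (\<phi> (\<sigma> p))) (e k ` inversions (runner t k D))) {..<m}"
    unfolding L
  proof (rule UNION_disjoint)
    show "\<forall>k\<in>{..<m}. finite (e k ` inversions (runner t k D))"
      using finite_subset[OF _ finT] res by blast
    show "\<forall>k\<in>{..<m}. \<forall>l\<in>{..<m}. k \<noteq> l \<longrightarrow>
        e k ` inversions (runner t k D) \<inter> e l ` inversions (runner t l D) = {}"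
    proof (intro ballI impI)
      fix k l assume "k \<in> {..<m}" "l \<in> {..<m}" "k \<noteq> l"
      then show "e k ` inversions (runner t k D) \<inter> e l ` inversions (runner t l D) = {}"
        using res[of k, symmetric] res[of l, symmetric] by auto
    qed
  qed simp
  also have "\<dots> = F (\<lambda>k. F (\<lambda>p. f (\<phi> (e k p)) (\<phi> (\<sigma> (e k p)))) (inversions (runner t k D))) {..<m}"
    by (intro cong[OF refl] reindex[unfolded comp_def] inj_onI) (use t in \<open>auto simp: e_def\<close>)
  finally show ?thesis by (simp add: e_def \<sigma>_def m_def case_prod_unfold)
qed

lemma bij_betw_div_boxes:
  assumes "is_partition la"
  shows "bij_betw (\<lambda>(i, j). (-1 - beta (conjugate la) j, beta la i))
    {u \<in> boxes la. hook la u \<in># hooks_t t la} (div_inversions t (maya la))"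
proof (rule bij_betw_subset[OF bij_betw_boxes_inversions[OF assms]])
  let ?f = "\<lambda>(i, j). (-1 - beta (conjugate la) j, beta la i)"
  have S: "{u \<in> boxes la. hook la u \<in># hooks_t t la} = {u \<in> boxes la. int t dvd hook la u}"
    by (auto simp: hooks_t_def hooks_def)
  have "?f ` {u \<in> boxes la. int t dvd hook la u} = {(a, b) \<in> ?f ` boxes la. int t dvd b - a}"
    by (auto simp: hook_eq image_iff) (force simp: hook_eq)+
  then show "?f ` {u \<in> boxes la. hook la u \<in># hooks_t t la} = div_inversions t (maya la)"
    using bij_betw_boxes_inversions[OF assms] unfolding S by (simp add: bij_betw_def div_inversions_def)
qed simp

text \<open>In a self-conjugate partition the box \<open>(i, j)\<close> gives
  \<open>a = -1 - beta la j\<close> and \<open>b = beta la i\<close>, so \<open>a + b < -1\<close>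
  means \<open>beta la i < beta la j\<close>, that is, \<open>i > j\<close>.\<close>

definition pair_sign :: "int \<times> int \<Rightarrow> int" where
  "pair_sign = (\<lambda>(a, b). if a + b < - 1 then - 1 else 1)"

lemma box_sign_eq:
  assumes "la \<in> self_conjugates" "(i, j) \<in> boxes la"
  shows "box_sign (i, j) = pair_sign (-1 - beta (conjugate la) j, beta la i)"
proof -
  have la: "is_partition la" "conjugate la = la"
    using assms(1) by (auto simp: self_conjugates_def partitions_def)
  have ij: "1 \<le> i" "1 \<le> j" using assms(2) by (auto simp: boxes_def)
  have "j < i \<longleftrightarrow> beta la i < beta la j"
    using beta_less[OF la(1) ij(2), of i] beta_less[OF la(1) ij(1), of j]
    by (cases i j rule: linorder_cases) auto
  then show ?thesis by (auto simp: box_sign_def pair_sign_def la(2))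
qed

text \<open>Reflection replaces \<open>a + b\<close> by \<open>-2 - (a + b)\<close> and flips the
  sign unless \<open>a + b = -1\<close>. In that case \<open>t\<close> would divide
  \<open>2 * k + 1\<close>, which lies strictly between 0 and \<open>t\<close>.\<close>

lemma pair_sign_reflect:
  assumes "2 * k + 1 < t"
  shows "pair_sign (- 1 - (int t * j + int k), - 1 - (int t * i + int k)) =
    - pair_sign (int t * i + int k, int t * j + int k)"
proof -
  have "int t * (i + j) + (2 * int k + 1) \<noteq> 0"
  proof
    assume "int t * (i + j) + (2 * int k + 1) = 0"
    then have "int t dvd 2 * int k + 1" by (metis dvd_triv_left dvd_add_right_iff dvd_0_right)
    then show False using assms zdvd_imp_le[of "int t" "2 * int k + 1"] by simp
  qed
  then show ?thesis by (auto simp: pair_sign_def algebra_simps)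
qed

text \<open>An inversion of a lower runner stands for two boxes that have the same hook length and
  opposite signs.\<close>

lemma (in comm_monoid_set) signed_div_boxes:
  assumes "odd t" "la \<in> BG t"
  shows "F (\<lambda>u. r (hook la u) (box_sign u)) {u \<in> boxes la. hook la u \<in># hooks_t t la} =
    F (\<lambda>k. F (\<lambda>(i, j). f (r (int t * (j - i)) 1) (r (int t * (j - i)) (- 1)))
        (inversions (runner t k (diagonal la)))) {..<(t - 1) div 2}"
proof -
  let ?D = "diagonal la" and ?S = "{u \<in> boxes la. hook la u \<in># hooks_t t la}"
  let ?g = "\<lambda>(i, j). (-1 - beta (conjugate la) j, beta la i)"
  define \<phi> where "\<phi> = (\<lambda>(a, b). r (b - a) (pair_sign (a, b)))"
  have sc: "la \<in> self_conjugates" and D: "?D \<inter> runner_boxes t ((t - 1) div 2) = {}"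
    using assms BG_iff by auto
  have part: "is_partition la" using sc by (simp add: self_conjugates_def partitions_def)
  have "F (\<lambda>u. r (hook la u) (box_sign u)) ?S = F (\<lambda>u. \<phi> (?g u)) ?S"
    using box_sign_eq[OF sc] by (intro cong[OF refl]) (auto simp: \<phi>_def hook_eq)
  also have "\<dots> = F \<phi> (div_inversions t (sym_maya ?D))"
    using reindex_bij_betw[OF bij_betw_div_boxes[OF part, of t]]
    unfolding maya_eq_sym_maya[OF sc] by simp
  also have "\<dots> = F (\<lambda>k. F (\<lambda>(i, j). f (\<phi> (int t * i + int k, int t * j + int k))
                        (\<phi> (- 1 - (int t * j + int k), - 1 - (int t * i + int k))))
           (inversions (runner t k ?D))) {..<(t - 1) div 2}"
    by (rule div_inversions_runners[OF assms(1) finite_diagonal[OF sc] D])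
  also have "\<dots> = F (\<lambda>k. F (\<lambda>(i, j). f (r (int t * (j - i)) 1) (r (int t * (j - i)) (- 1)))
        (inversions (runner t k ?D))) {..<(t - 1) div 2}"
  proof (intro cong[OF refl])
    fix k and p :: "int \<times> int" assume "k \<in> {..<(t - 1) div 2}"
    then have k: "2 * k + 1 < t" using assms(1) by auto
    obtain i j :: int where p: "p = (i, j)" by (cases p)
    \<comment> \<open>Which of the two boxes has sign 1 depends on the pair, but commutativity makes
      both cases agree.\<close>
    have "pair_sign (int t * i + int k, int t * j + int k) = 1 \<or>
        pair_sign (int t * i + int k, int t * j + int k) = - 1"
      by (simp add: pair_sign_def)
    then show "(case p of (i, j) \<Rightarrow> f (\<phi> (int t * i + int k, int t * j + int k))
        (\<phi> (- 1 - (int t * j + int k), - 1 - (int t * i + int k)))) =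
      (case p of (i, j) \<Rightarrow> f (r (int t * (j - i)) 1) (r (int t * (j - i)) (- 1)))"
      unfolding \<phi>_def p prod.case pair_sign_reflect[OF k]
      by (auto simp: right_diff_distrib commute)
  qed
  finally show ?thesis .
qed

lemma prod_inversions: "(\<Prod>(i, j)\<in>inversions Z. g (j - i)) = (\<Prod>h\<in>#inversion_hooks Z. g h)"
  by (simp add: inversion_hooks_def prod_unfold_prod_mset multiset.map_comp comp_def case_prod_unfold)

lemma sum_inversions: "(\<Sum>(i, j)\<in>inversions Z. g (j - i)) = (\<Sum>h\<in>#inversion_hooks Z. g h)"
  by (simp add: inversion_hooks_def sum_unfold_sum_mset multiset.map_comp comp_def case_prod_unfold)

text \<open>The constant summand 1 counts each runner hook once for either sign; this doubling is
  the source of \<open>x^2\<close>.\<close>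

lemma size_hooks_t:
  assumes "odd t" "la \<in> BG t"
  shows "size (hooks_t t la) = (\<Sum>k<(t - 1) div 2. 2 * size (inversion_hooks (runner t k (diagonal la))))"
proof -
  have "size (hooks_t t la) = card {u \<in> boxes la. int t dvd hook la u}"
    by (simp add: hooks_t_def hooks_def filter_mset_image_mset)
  also have "{u \<in> boxes la. int t dvd hook la u} = {u \<in> boxes la. hook la u \<in># hooks_t t la}"
    by (auto simp: hooks_t_def hooks_def)
  also have "card \<dots> = (\<Sum>u\<in>\<dots>. 1)" by simp
  also have "\<dots> = (\<Sum>k<(t - 1) div 2. 2 * size (inversion_hooks (runner t k (diagonal la))))"
    using sum.signed_div_boxes[OF assms, of "\<lambda>_ _. 1 :: nat"]
    by (simp add: inversion_hooks_def case_prod_unfold mult_2)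
  finally show ?thesis .
qed

section \<open>Weighted generating series\<close>

text \<open>Junk: a coefficient whose fibre is infinite is 0.\<close>

definition weight_series :: "'b set \<Rightarrow> ('b \<Rightarrow> nat) \<Rightarrow> ('b \<Rightarrow> 'a) \<Rightarrow> 'a::comm_ring_1 fps" where
  "weight_series A sz w = Abs_fps (\<lambda>n. \<Sum>a\<in>{a \<in> A. sz a = n}. w a)"

definition finite_fibres :: "'b set \<Rightarrow> ('b \<Rightarrow> nat) \<Rightarrow> bool" where
  "finite_fibres A sz \<longleftrightarrow> (\<forall>n. finite {a \<in> A. sz a = n})"

lemma weight_series_bij:
  assumes "bij_betw h A B" "\<And>a. a \<in> A \<Longrightarrow> sz' (h a) = sz a" "\<And>a. a \<in> A \<Longrightarrow> w' (h a) = w a"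
  shows "weight_series A sz w = weight_series B sz' w'"
proof (rule fps_ext)
  fix n
  have "bij_betw h {a \<in> A. sz a = n} {b \<in> B. sz' b = n}"
    by (rule bij_betw_subset[OF assms(1)]) (use assms(1,2) in \<open>auto simp: bij_betw_def image_iff\<close>)
  from sum.reindex_bij_betw[OF this, of w']
  show "fps_nth (weight_series A sz w) n = fps_nth (weight_series B sz' w') n"
    using assms(3) by (simp add: weight_series_def)
qed

lemma weight_series_cong:
  assumes "\<And>a. a \<in> A \<Longrightarrow> w a = w' a"
  shows "weight_series A sz w = weight_series A sz w'"
  using assms by (auto simp: weight_series_def fps_eq_iff intro!: sum.cong)

lemma weight_series_add:
  "weight_series A sz (\<lambda>a. w a + w' a) = weight_series A sz w + weight_series A sz w'"
  by (simp add: weight_series_def fps_eq_iff sum.distrib)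

lemma weight_series_times:
  assumes "finite_fibres A sz" "finite_fibres B sz'"
  shows "weight_series (A \<times> B) (\<lambda>(a, b). sz a + sz' b) (\<lambda>(a, b). w a * w' b) =
    weight_series A sz w * weight_series B sz' w'"
proof (rule fps_ext)
  fix n
  let ?A = "\<lambda>i. {a \<in> A. sz a = i}" and ?B = "\<lambda>i. {b \<in> B. sz' b = i}"
  have fin: "finite (?A i)" "finite (?B i)" for i
    using assms by (auto simp: finite_fibres_def)
  have split: "{p \<in> A \<times> B. (case p of (a, b) \<Rightarrow> sz a + sz' b) = n} = (\<Union>i\<in>{0..n}. ?A i \<times> ?B (n - i))"
    by auto
  have "(\<Sum>p\<in>{p \<in> A \<times> B. (case p of (a, b) \<Rightarrow> sz a + sz' b) = n}. case p of (a, b) \<Rightarrow> w a * w' b) =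
      (\<Sum>i = 0..n. \<Sum>p\<in>?A i \<times> ?B (n - i). case p of (a, b) \<Rightarrow> w a * w' b)"
    unfolding split by (rule sum.UNION_disjoint) (use fin in auto)
  also have "\<dots> = (\<Sum>i = 0..n. (\<Sum>a\<in>?A i. w a) * (\<Sum>b\<in>?B (n - i). w' b))"
    by (simp add: sum_product sum.cartesian_product)
  finally show "fps_nth (weight_series (A \<times> B) (\<lambda>(a, b). sz a + sz' b) (\<lambda>(a, b). w a * w' b)) n =
      fps_nth (weight_series A sz w * weight_series B sz' w') n"
    by (simp add: weight_series_def fps_mult_nth)
qed

lemma weight_series_Un:
  assumes "finite_fibres A sz" "finite_fibres B sz" "A \<inter> B = {}"
  shows "weight_series (A \<union> B) sz w = weight_series A sz w + weight_series B sz w"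
proof (rule fps_ext)
  fix n
  have "{a \<in> A \<union> B. sz a = n} = {a \<in> A. sz a = n} \<union> {a \<in> B. sz a = n}" by auto
  then show "fps_nth (weight_series (A \<union> B) sz w) n =
      fps_nth (weight_series A sz w + weight_series B sz w) n"
    using assms by (auto simp: weight_series_def finite_fibres_def intro!: sum.union_disjoint)
qed

lemma weight_series_shift: "weight_series A (\<lambda>a. c + sz a) w = fps_X ^ c * weight_series A sz w"
proof (rule fps_ext)
  fix n
  have "{a \<in> A. c + sz a = n} = (if n < c then {} else {a \<in> A. sz a = n - c})" by auto
  then show "fps_nth (weight_series A (\<lambda>a. c + sz a) w) n =
      fps_nth (fps_X ^ c * weight_series A sz w) n"
    by (simp add: weight_series_def fps_X_power_mult_nth)
qed

lemma finite_fibres_subset: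
  assumes "finite_fibres B sz" "A \<subseteq> B"
  shows "finite_fibres A sz"
  unfolding finite_fibres_def
proof
  fix n
  have "finite {b \<in> B. sz b = n}" using assms(1) by (simp add: finite_fibres_def)
  then show "finite {a \<in> A. sz a = n}" by (rule rev_finite_subset) (use assms(2) in auto)
qed

lemma finite_fibres_partitions:
  assumes "d > 0"
  shows "finite_fibres partitions (\<lambda>nu. d * sum_list nu)"
proof -
  have "finite {nu \<in> partitions. d * sum_list nu = n}" for n
    by (rule finite_subset[OF _ finite_partitions_of[of "n div d"]]) (use assms in auto)
  then show ?thesis by (simp add: finite_fibres_def)
qed

section \<open>The partition series as the inverse of an infinite product\<close>

definition bounded_partitions :: "nat \<Rightarrow> nat list set" where
  "bounded_partitions N = {la \<in> partitions. set la \<subseteq> {..N}}"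

text \<open>Either the first part is \<open>Suc N\<close> or no part is. The same set occurs on the
  right, so the series satisfies \<open>P (N + 1) = P N + X ^ (d * (N + 1)) * P (N + 1)\<close>,
  which produces one factor of the product.\<close>

lemma bounded_partitions_Suc:
  "bounded_partitions (Suc N) =
    bounded_partitions N \<union> (\<lambda>la. Suc N # la) ` bounded_partitions (Suc N)"
proof (intro equalityI subsetI)
  fix la assume la: "la \<in> bounded_partitions (Suc N)"
  show "la \<in> bounded_partitions N \<union> (\<lambda>la. Suc N # la) ` bounded_partitions (Suc N)"
  proof (cases "\<exists>mu. la = Suc N # mu")
    case True
    then obtain mu where "la = Suc N # mu" by blast
    moreover from this la have "mu \<in> bounded_partitions (Suc N)"
      by (auto simp: bounded_partitions_def partitions_def is_partition_def)
    ultimately show ?thesis by blast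
  next
    case False
    then have "set la \<subseteq> {..N}"
      using la by (cases la)
        (force simp: bounded_partitions_def partitions_def is_partition_def)+
    then show ?thesis using la by (simp add: bounded_partitions_def)
  qed
qed (auto simp: bounded_partitions_def partitions_def is_partition_def)

lemma bounded_partitions_0: "bounded_partitions 0 = {[]}"
proof (intro equalityI subsetI)
  fix la assume "la \<in> bounded_partitions 0"
  then show "la \<in> {[]}"
    by (cases la) (auto simp: bounded_partitions_def partitions_def is_partition_def)
qed (auto simp: bounded_partitions_def partitions_def is_partition_def)

lemma bounded_partition_series:
  assumes "d > 0"
  shows "weight_series (bounded_partitions N) (\<lambda>nu. d * sum_list nu) (\<lambda>_. 1) *
    (\<Prod>j<N. 1 - fps_X ^ d * (fps_X ^ d) ^ j) = (1 :: 'a::comm_ring_1 fps)"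
proof (induction N)
  case 0
  have "{a. a = [] \<and> d * sum_list a = n} = (if n = 0 then {[]} else {})" for n
    by auto
  then show ?case by (auto simp: weight_series_def bounded_partitions_0 fps_eq_iff)
next
  case (Suc N)
  let ?P = "\<lambda>N. weight_series (bounded_partitions N) (\<lambda>nu. d * sum_list nu) (\<lambda>_. 1) :: 'a fps"
  have fin: "finite_fibres A (\<lambda>nu. d * sum_list nu)" if "A \<subseteq> partitions" for A
    using finite_fibres_subset[OF finite_fibres_partitions[OF assms] that] .
  have sub: "bounded_partitions N \<subseteq> partitions" for N by (auto simp: bounded_partitions_def)
  have "(\<lambda>la. Suc N # la) ` bounded_partitions (Suc N) \<subseteq> partitions"
    using bounded_partitions_Suc sub by blast
  moreover have "bounded_partitions N \<inter> (\<lambda>la. Suc N # la) ` bounded_partitions (Suc N) = {}"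
    by (auto simp: bounded_partitions_def)
  ultimately have "?P (Suc N) = ?P N +
      weight_series ((\<lambda>la. Suc N # la) ` bounded_partitions (Suc N)) (\<lambda>nu. d * sum_list nu) (\<lambda>_. 1)"
    by (subst bounded_partitions_Suc) (intro weight_series_Un fin sub)
  also have "weight_series ((\<lambda>la. Suc N # la) ` bounded_partitions (Suc N)) (\<lambda>nu. d * sum_list nu) (\<lambda>_. 1) =
      weight_series (bounded_partitions (Suc N)) (\<lambda>nu. d * Suc N + d * sum_list nu) (\<lambda>_. 1 :: 'a)"
    by (rule weight_series_bij[symmetric, of "\<lambda>la. Suc N # la"])
      (auto simp: bij_betw_def inj_on_def algebra_simps)
  also have "\<dots> = fps_X ^ (d * Suc N) * ?P (Suc N)"
    by (rule weight_series_shift)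
  finally have "?P (Suc N) * (1 - fps_X ^ d * (fps_X ^ d) ^ N) = ?P N"
    by (simp add: algebra_simps flip: power_mult power_add)
  moreover have "a * (c * b) = (a * b) * c" for a b c :: "'a fps" by (simp add: ac_simps)
  ultimately show ?case using Suc by (simp only: prod.lessThan_Suc)
qed

text \<open>Convergence of formal power series makes each coefficient eventually constant, so
  infinite products can be handled through finite ones.\<close>

lemma qpoch_inf_nth:
  assumes "fps_nth a 0 = 0" "fps_nth p 0 = 0"
  shows "\<forall>\<^sub>F N in sequentially. fps_nth (\<Prod>j<N. 1 - a * p ^ j) i = fps_nth (qpoch_inf a p) i"
proof -
  have "(\<lambda>N. \<Prod>j\<le>N. 1 - a * p ^ j) \<longlonglongrightarrow> qpoch_inf a p"
    by (rule has_prod_imp_tendsto[OF qpoch_inf_has_prod(1)[OF assms]])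
  then have "(\<lambda>N. \<Prod>j<N. 1 - a * p ^ j) \<longlonglongrightarrow> qpoch_inf a p"
    by (subst (asm) LIMSEQ_lessThan_iff_atMost[symmetric])
  then show ?thesis by (simp add: tendsto_fps_iff)
qed

lemma partition_series_times_qpoch:
  assumes "d > 0"
  shows "weight_series partitions (\<lambda>nu. d * sum_list nu) (\<lambda>_. 1) *
    qpoch_inf (fps_X ^ d) (fps_X ^ d) = 1" (is "?P * ?Q = 1")
proof (rule fps_ext)
  fix n
  let ?B = "\<lambda>N. weight_series (bounded_partitions N) (\<lambda>nu. d * sum_list nu) (\<lambda>_. 1 :: complex poly)"
  let ?q = "\<lambda>N. \<Prod>j<N. 1 - fps_X ^ d * (fps_X ^ d) ^ j :: complex poly fps"
  have zero: "fps_nth (fps_X ^ d :: complex poly fps) 0 = 0" using assms by simp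
  \<comment> \<open>Coefficient \<open>n\<close> of a product involves only the coefficients up to
    \<open>n\<close> of its factors, so a single bound \<open>N0\<close> suffices; taking also
    \<open>N >= n\<close> admits every partition that contributes.\<close>
  have "\<forall>\<^sub>F N in sequentially. \<forall>i\<le>n. fps_nth (?q N) i = fps_nth ?Q i"
    using eventually_ball_finite[of "{..n}" "\<lambda>N i. fps_nth (?q N) i = fps_nth ?Q i" sequentially]
      qpoch_inf_nth[OF zero zero] by (simp add: Ball_def)
  then obtain N0 where N0: "\<And>N i. N \<ge> N0 \<Longrightarrow> i \<le> n \<Longrightarrow> fps_nth (?q N) i = fps_nth ?Q i"
    by (auto simp: eventually_sequentially)
  define N where "N = max N0 n"
  have "fps_nth (?B N) i = fps_nth ?P i" if "i \<le> n" for i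
  proof -
    have "la \<in> bounded_partitions N" if "la \<in> partitions" "d * sum_list la = i" for la
    proof -
      have "x \<le> N" if "x \<in> set la" for x
      proof -
        have "x \<le> sum_list la" by (rule member_le_sum_list) (use that in auto)
        also have "\<dots> \<le> d * sum_list la" using assms by simp
        finally show ?thesis using \<open>d * sum_list la = i\<close> \<open>i \<le> n\<close> by (simp add: N_def)
      qed
      then show ?thesis using that by (auto simp: bounded_partitions_def)
    qed
    then have "{la \<in> bounded_partitions N. d * sum_list la = i} = {la \<in> partitions. d * sum_list la = i}"
      by (auto simp: bounded_partitions_def)
    then show ?thesis by (simp add: weight_series_def)
  qed
  then have "fps_nth (?P * ?Q) n = fps_nth (?B N * ?q N) n"
    using N0[of N] unfolding fps_mult_nth by (intro sum.cong) (auto simp: N_def)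
  then show "fps_nth (?P * ?Q) n = fps_nth 1 n"
    unfolding bounded_partition_series[OF assms] .
qed

section \<open>Finite sets of diagonal boxes counted by size\<close>

definition odd_sum :: "nat set \<Rightarrow> nat" where
  "odd_sum D = (\<Sum>b\<in>D. 2 * b + 1)"

definition fin_subsets :: "nat set \<Rightarrow> nat set set" where
  "fin_subsets R = {D. finite D \<and> D \<subseteq> R}"

lemma fin_subset_bound:
  assumes "finite D" "b \<in> D"
  shows "b < odd_sum D"
  using member_le_sum[OF assms(2), of "\<lambda>b. 2 * b + 1"] assms(1) by (simp add: odd_sum_def)

lemma finite_fibres_fin_subsets:
  assumes "d > 0"
  shows "finite_fibres (fin_subsets R) (\<lambda>D. d * odd_sum D)"
  unfolding finite_fibres_def
proof
  fix n
  have "{D \<in> fin_subsets R. d * odd_sum D = n} \<subseteq> Pow {..n div d}"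
    using fin_subset_bound assms by (fastforce simp: fin_subsets_def)
  then show "finite {D \<in> fin_subsets R. d * odd_sum D = n}" by (rule finite_subset) simp
qed

text \<open>In the expansion of the product, the factor \<open>1 + X ^ (d * (2 * j + 1))\<close>
  decides whether \<open>j\<close> belongs to \<open>D\<close>.\<close>

lemma fin_subsets_series_finite:
  assumes "d > 0"
  shows "weight_series (Pow {..<N}) (\<lambda>D. d * odd_sum D) (\<lambda>_. 1) =
    (\<Prod>j<N. 1 - (- (fps_X ^ d)) * (fps_X ^ (2 * d)) ^ j :: 'a::comm_ring_1 fps)"
proof (induction N)
  case 0
  have "{a. a = {} \<and> d * odd_sum a = n} = (if n = 0 then {{}} else {})" for n
    by (auto simp: odd_sum_def)
  then show ?case by (auto simp: weight_series_def fps_eq_iff)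
next
  case (Suc N)
  let ?W = "\<lambda>A. weight_series A (\<lambda>D. d * odd_sum D) (\<lambda>_. 1) :: 'a fps"
  have fin: "finite_fibres A (\<lambda>D. d * odd_sum D)" if "A \<subseteq> Pow {..<M}" for A M
    by (rule finite_fibres_subset[OF finite_fibres_fin_subsets[OF assms, of UNIV]])
      (use that in \<open>auto simp: fin_subsets_def intro: finite_subset\<close>)
  have "Pow {..<Suc N} = Pow {..<N} \<union> insert N ` Pow {..<N}"
    by (simp add: lessThan_Suc Pow_insert)
  moreover have "insert N ` Pow {..<N} \<subseteq> Pow {..<Suc N}" by auto
  moreover have "Pow {..<N} \<inter> insert N ` Pow {..<N} = {}" by auto
  ultimately have "?W (Pow {..<Suc N}) = ?W (Pow {..<N}) + ?W (insert N ` Pow {..<N})"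
    using weight_series_Un fin by (metis order_refl)
  also have "?W (insert N ` Pow {..<N}) =
      weight_series (Pow {..<N}) (\<lambda>D. d * (2 * N + 1) + d * odd_sum D) (\<lambda>_. 1)"
  proof (rule weight_series_bij[symmetric])
    have notin: "N \<notin> D" if "D \<in> Pow {..<N}" for D using that by auto
    show "bij_betw (insert N) (Pow {..<N}) (insert N ` Pow {..<N})"
      using notin by (auto simp: bij_betw_def inj_on_def dest!: insert_ident[THEN iffD1, rotated 2])
    show "d * odd_sum (insert N D) = d * (2 * N + 1) + d * odd_sum D" if "D \<in> Pow {..<N}" for D
      using notin[OF that] finite_subset[of D "{..<N}"] that by (simp add: odd_sum_def algebra_simps)
  qed auto
  also have "\<dots> = fps_X ^ (d * (2 * N + 1)) * ?W (Pow {..<N})"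
    by (rule weight_series_shift)
  also have "fps_X ^ (d * (2 * N + 1)) = (fps_X ^ d * (fps_X ^ (2 * d)) ^ N :: 'a fps)"
    by (simp add: algebra_simps flip: power_mult power_add)
  finally show ?case by (simp add: Suc algebra_simps)
qed

text \<open>Used with \<open>d = 1\<close> for all self-conjugate partitions and with
  \<open>d = t\<close> for the middle runner.\<close>

lemma fin_subsets_series:
  assumes "d > 0"
  shows "weight_series (fin_subsets UNIV) (\<lambda>D. d * odd_sum D) (\<lambda>_. 1) =
    qpoch_inf (- (fps_X ^ d)) (fps_X ^ (2 * d))"
proof (rule fps_ext)
  fix n
  let ?q = "\<lambda>N. \<Prod>j<N. 1 - (- (fps_X ^ d)) * (fps_X ^ (2 * d)) ^ j :: complex poly fps"
  have "\<forall>\<^sub>F N in sequentially. fps_nth (?q N) n = fps_nth (qpoch_inf (- (fps_X ^ d)) (fps_X ^ (2 * d))) n"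
    using assms by (intro qpoch_inf_nth) auto
  then obtain N0 where N0: "\<And>N. N \<ge> N0 \<Longrightarrow>
      fps_nth (?q N) n = fps_nth (qpoch_inf (- (fps_X ^ d)) (fps_X ^ (2 * d))) n"
    by (auto simp: eventually_sequentially)
  define N where "N = max N0 n"
  have "b < N" if "finite D" "d * odd_sum D = n" "b \<in> D" for D b
  proof -
    have "odd_sum D \<le> n" using that(2) assms by auto
    then show ?thesis using fin_subset_bound[OF that(1,3)] by (simp add: N_def)
  qed
  then have "{D \<in> fin_subsets UNIV. d * odd_sum D = n} = {D \<in> Pow {..<N}. d * odd_sum D = n}"
    by (auto simp: fin_subsets_def intro: finite_subset)
  then have "fps_nth (weight_series (fin_subsets UNIV) (\<lambda>D. d * odd_sum D) (\<lambda>_. 1)) n = fps_nth (?q N) n"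
    by (subst fin_subsets_series_finite[OF assms, symmetric]) (simp add: weight_series_def)
  then show "fps_nth (weight_series (fin_subsets UNIV) (\<lambda>D. d * odd_sum D) (\<lambda>_. 1)) n =
      fps_nth (qpoch_inf (- (fps_X ^ d)) (fps_X ^ (2 * d))) n"
    using N0[of N] by (simp add: N_def)
qed

lemma weight_series_fin_subsets_Un:
  assumes "R \<inter> S = {}"
  shows "weight_series (fin_subsets (R \<union> S)) odd_sum w =
    weight_series (fin_subsets R \<times> fin_subsets S) (\<lambda>(D, E). odd_sum D + odd_sum E) (\<lambda>(D, E). w (D \<union> E))"
proof (rule weight_series_bij[symmetric, of "\<lambda>(D, E). D \<union> E"])
  show "bij_betw (\<lambda>(D, E). D \<union> E) (fin_subsets R \<times> fin_subsets S) (fin_subsets (R \<union> S))"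
    by (rule bij_betw_byWitness[of _ "\<lambda>D. (D \<inter> R, D \<inter> S)"])
      (use assms in \<open>auto simp: fin_subsets_def\<close>)
  show "odd_sum (case p of (D, E) \<Rightarrow> D \<union> E) = (case p of (D, E) \<Rightarrow> odd_sum D + odd_sum E)"
    if "p \<in> fin_subsets R \<times> fin_subsets S" for p
    using that assms by (auto simp: fin_subsets_def odd_sum_def intro!: sum.union_disjoint)
qed auto

lemma weight_series_fin_subsets_times:
  assumes "R \<inter> S = {}"
    and "\<And>D E. D \<in> fin_subsets R \<Longrightarrow> E \<in> fin_subsets S \<Longrightarrow> w (D \<union> E) = u D * v E"
  shows "weight_series (fin_subsets (R \<union> S)) odd_sum w =
    weight_series (fin_subsets R) odd_sum u * weight_series (fin_subsets S) odd_sum v"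
proof -
  have "finite_fibres (fin_subsets R) odd_sum" for R
    using finite_fibres_fin_subsets[of 1 R] by simp
  then show ?thesis
    unfolding weight_series_fin_subsets_Un[OF assms(1)]
    by (subst weight_series_times[symmetric]) (auto intro!: weight_series_cong simp: assms(2))
qed

text \<open>The substitution gives a partition the factor \<open>x^2\<close> per box, that is, per
  hook, and scales its size by \<open>d\<close>.\<close>

lemma lift_series_compose:
  assumes "d > 0"
  shows "lift_series (partition_series partitions w) oo (x_var ^ 2 * q_var ^ d) =
    weight_series partitions (\<lambda>nu. d * sum_list nu) (\<lambda>nu. monom (w nu) (2 * sum_list nu))"
proof (rule fps_ext)
  fix n
  let ?F = "partition_series partitions w"
  have pow: "(x_var ^ 2 * q_var ^ d) ^ i = fps_const (monom 1 (2 * i)) * fps_X ^ (d * i)" for i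
  proof -
    have "x_var ^ 2 = fps_const (monom 1 2)"
      by (simp add: x_var_def monom_altdef fps_const_power)
    then show ?thesis
      by (simp add: power_mult_distrib power_mult fps_const_power monom_power)
  qed
  have "fps_nth (lift_series ?F oo (x_var ^ 2 * q_var ^ d)) n =
      (\<Sum>i = 0..n. if n = d * i then [:fps_nth ?F i:] * monom 1 (2 * i) else 0)"
    unfolding fps_compose_nth pow
    by (intro sum.cong) (auto simp: lift_series_def fps_X_power_nth)
  also have "\<dots> = (\<Sum>nu\<in>{nu \<in> partitions. d * sum_list nu = n}. monom (w nu) (2 * sum_list nu))"
  proof (cases "d dvd n")
    case True
    then obtain m where m: "n = d * m" by auto
    have "(\<Sum>i = 0..n. if n = d * i then [:fps_nth ?F i:] * monom 1 (2 * i) else 0) =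
        [:fps_nth ?F m:] * monom 1 (2 * m)"
    proof -
      have "n = d * i \<longleftrightarrow> i = m" for i using assms by (auto simp: m)
      moreover have "m \<le> n" using assms by (simp add: m)
      ultimately show ?thesis by simp
    qed
    also have "\<dots> = monom (\<Sum>nu\<in>{nu \<in> partitions. sum_list nu = m}. w nu) (2 * m)"
      by (simp add: partition_series_def smult_monom)
    also have "\<dots> = (\<Sum>nu\<in>{nu \<in> partitions. sum_list nu = m}. monom (w nu) (2 * sum_list nu))"
      by (simp add: monom_sum)
    finally show ?thesis using assms by (simp add: m)
  next
    case False
    then have "n \<noteq> d * i" for i by auto
    then have "{nu \<in> partitions. d * sum_list nu = n} = {}" "\<forall>i. (n = d * i) = False" by auto
    then show ?thesis by (simp only: if_False sum.neutral_const sum.empty simp_thms)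
  qed
  finally show "fps_nth (lift_series ?F oo (x_var ^ 2 * q_var ^ d)) n =
      fps_nth (weight_series partitions (\<lambda>nu. d * sum_list nu) (\<lambda>nu. monom (w nu) (2 * sum_list nu))) n"
    by (simp add: weight_series_def)
qed

section \<open>Factorisation over the runners\<close>

definition runner_hooks :: "nat \<Rightarrow> nat set \<Rightarrow> nat \<Rightarrow> int multiset" where
  "runner_hooks t D k = inversion_hooks (runner t k D)"

text \<open>A theta series, since the energy is quadratic in the charge. Only the product of these
  series over the lower runners is evaluated.\<close>

definition theta :: "nat \<Rightarrow> nat \<Rightarrow> 'a::comm_ring_1 fps" where
  "theta t k = weight_series UNIV (charge_energy t k) (\<lambda>_. 1)"

text \<open>The weight sees only the hook multiset, which covers the weights of \<open>f\<close>, of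
  \<open>g\<close> and the constant 1. The size is scaled by \<open>2 * t\<close> because a box of a
  runner partition adds \<open>2 * t\<close> to the size.\<close>

definition hook_series :: "nat \<Rightarrow> (int multiset \<Rightarrow> 'a) \<Rightarrow> 'a::comm_ring_1 fps" where
  "hook_series t w = weight_series partitions (\<lambda>nu. 2 * t * sum_list nu) (\<lambda>nu. w (hooks nu))"

text \<open>Charge and partition of a runner vary independently, the size is additive in them, and
  the weight ignores the charge.\<close>

lemma runner_series:
  assumes "k < t" "k \<noteq> mirror t k"
  shows "weight_series (fin_subsets (runner_boxes t k)) odd_sum (\<lambda>D. w (runner_hooks t D k)) =
    theta t k * hook_series t w"
proof -
  have "weight_series (UNIV \<times> partitions) (\<lambda>(s, nu). charge_energy t k s + 2 * t * sum_list nu)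
      (\<lambda>(s, nu). 1 * w (hooks nu)) = theta t k * hook_series t w"
    unfolding theta_def hook_series_def using assms finite_charge_energy[OF assms(1)]
    by (intro weight_series_times finite_fibres_partitions) (auto simp: finite_fibres_def)
  moreover have "weight_series (UNIV \<times> partitions) (\<lambda>(s, nu). charge_energy t k s + 2 * t * sum_list nu)
      (\<lambda>(s, nu). 1 * w (hooks nu)) =
    weight_series (fin_subsets (runner_boxes t k)) odd_sum (\<lambda>D. w (runner_hooks t D k))"
  proof (rule weight_series_bij)
    show "bij_betw (runner_partition t k) (UNIV \<times> partitions) (fin_subsets (runner_boxes t k))"
      using bij_betw_runner_partition[OF assms] by (simp add: fin_subsets_def)
  next
    fix p :: "int \<times> nat list" assume "p \<in> UNIV \<times> partitions"
    then obtain s nu where p: "p = (s, nu)" "is_partition nu" by (auto simp: partitions_def)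
    show "odd_sum (runner_partition t k p) = (case p of (s, nu) \<Rightarrow> charge_energy t k s + 2 * t * sum_list nu)"
      by (simp only: p prod.case odd_sum_def sum_runner_partition[OF assms p(2)])
    show "w (runner_hooks t (runner_partition t k p) k) = (case p of (s, nu) \<Rightarrow> 1 * w (hooks nu))"
      by (simp add: p(1) runner_hooks_def runner_runner_partition[OF assms] inversion_hooks_shift
          inversion_hooks_maya[OF p(2)])
  qed
  ultimately show ?thesis by simp
qed

section \<open>Adding the runners one at a time\<close>

lemma runner_hooks_Un:
  assumes "k < t" "E \<inter> runner_boxes t k = {}"
  shows "runner_hooks t (D \<union> E) k = runner_hooks t D k" "runner_hooks t (E \<union> D) k = runner_hooks t D k"
proof -
  have "(D \<union> E) \<inter> runner_boxes t k = D \<inter> runner_boxes t k" using assms(2) by blast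
  then have "runner t k (D \<union> E) = runner t k D"
    using runner_restrict[OF assms(1)] by metis
  then show "runner_hooks t (D \<union> E) k = runner_hooks t D k" by (simp add: runner_hooks_def)
  then show "runner_hooks t (E \<union> D) k = runner_hooks t D k" by (simp add: Un_commute)
qed

lemma runner_boxes_disjoint:
  assumes "k < l" "l \<le> (t - 1) div 2" "odd t"
  shows "runner_boxes t k \<inter> runner_boxes t l = {}"
  using assms by (auto simp: runner_boxes_def mirror_def elim!: oddE)

definition lower_boxes :: "nat \<Rightarrow> nat \<Rightarrow> nat set" where
  "lower_boxes t j = (\<Union>k<j. runner_boxes t k)"

lemma lower_boxes_Suc: "lower_boxes t (Suc j) = lower_boxes t j \<union> runner_boxes t j"
  by (auto simp: lower_boxes_def lessThan_Suc)

lemma lower_boxes_disjoint: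
  assumes "j \<le> (t - 1) div 2" "odd t"
  shows "lower_boxes t j \<inter> runner_boxes t j = {}"
  using runner_boxes_disjoint[OF _ assms] by (auto simp: lower_boxes_def)

lemma lower_boxes_Un_middle:
  assumes "odd t"
  shows "lower_boxes t ((t - 1) div 2) \<union> runner_boxes t ((t - 1) div 2) = UNIV"
proof -
  obtain m where t: "t = 2 * m + 1" using assms by (auto elim: oddE)
  have "b \<in> lower_boxes t m \<union> runner_boxes t m" for b
  proof -
    define r where "r = b mod t"
    have "r < t" by (simp add: r_def t)
    then consider "r < m" | "r = m" | "mirror t r < m" "r = mirror t (mirror t r)"
      unfolding mirror_def t by linarith
    moreover have "b \<in> runner_boxes t r" by (simp add: runner_boxes_def r_def)
    moreover have "b \<in> runner_boxes t (mirror t r)" if "r = mirror t (mirror t r)"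
      using that by (simp add: runner_boxes_def flip: r_def)
    ultimately show ?thesis unfolding lower_boxes_def by cases blast+
  qed
  then show ?thesis by (auto simp: t)
qed

lemma weight_split_runner:
  assumes "Suc j \<le> (t - 1) div 2" "odd t" "D \<in> fin_subsets (lower_boxes t j)"
    "E \<in> fin_subsets (runner_boxes t j)"
  shows "k < j \<Longrightarrow> runner_hooks t (D \<union> E) k = runner_hooks t D k"
    and "runner_hooks t (D \<union> E) j = runner_hooks t E j"
proof -
  have jt: "j < t" using assms(1) by auto
  have "D \<inter> runner_boxes t j = {}"
    using lower_boxes_disjoint[of j t] assms by (auto simp: fin_subsets_def)
  then show "runner_hooks t (D \<union> E) j = runner_hooks t E j" by (rule runner_hooks_Un(2)[OF jt])
  assume k: "k < j"
  then have "E \<inter> runner_boxes t k = {}"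
    using runner_boxes_disjoint[of k j t] assms by (auto simp: fin_subsets_def)
  then show "runner_hooks t (D \<union> E) k = runner_hooks t D k"
    using k jt by (intro runner_hooks_Un) auto
qed

lemma fin_subsets_empty: "fin_subsets {} = {{}}"
  by (auto simp: fin_subsets_def)

lemma weight_series_fin_subsets_empty:
  "weight_series (fin_subsets {}) odd_sum w = fps_const (w {})"
proof -
  have "{a. a = {} \<and> odd_sum a = n} = (if n = 0 then {{}} else {})" for n
    by (auto simp: odd_sum_def)
  then show ?thesis by (auto simp: weight_series_def fin_subsets_empty fps_eq_iff)
qed

lemma runner_index:
  assumes "Suc j \<le> (t - 1) div 2"
  shows "j < t" "j \<noteq> mirror t j"
  using assms by (auto simp: mirror_def)

text \<open>The elements of \<open>D\<close> that belong to a new runner leave the earlier runners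
  unchanged, so each step multiplies by one runner series.\<close>

lemma lower_series_prod:
  assumes "odd t" "j \<le> (t - 1) div 2"
  shows "weight_series (fin_subsets (lower_boxes t j)) odd_sum (\<lambda>D. \<Prod>k<j. u (runner_hooks t D k)) =
    (\<Prod>k<j. theta t k) * hook_series t u ^ j"
  using assms(2)
proof (induction j)
  case 0
  then show ?case by (simp add: lower_boxes_def weight_series_fin_subsets_empty)
next
  case (Suc j)
  have "weight_series (fin_subsets (lower_boxes t (Suc j))) odd_sum (\<lambda>D. \<Prod>k<Suc j. u (runner_hooks t D k)) =
    weight_series (fin_subsets (lower_boxes t j)) odd_sum (\<lambda>D. \<Prod>k<j. u (runner_hooks t D k)) *
    weight_series (fin_subsets (runner_boxes t j)) odd_sum (\<lambda>E. u (runner_hooks t E j))"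
    unfolding lower_boxes_Suc
  proof (rule weight_series_fin_subsets_times)
    show "lower_boxes t j \<inter> runner_boxes t j = {}"
      using Suc.prems assms(1) by (intro lower_boxes_disjoint) auto
  qed (simp add: weight_split_runner[OF Suc.prems assms(1)])
  then show ?case
    using Suc runner_series[OF runner_index[OF Suc.prems], of u] by (simp add: ac_simps)
qed

text \<open>A product times a sum over the runners marks one runner, which has weight
  \<open>v\<close>, while the others have weight \<open>u\<close>. The hook series do not depend on
  the runner, so the \<open>j\<close> choices of the mark give the factor
  \<open>of_nat j\<close>.\<close>

lemma lower_series_sum:
  assumes "odd t" "j \<le> (t - 1) div 2"
  shows "weight_series (fin_subsets (lower_boxes t j)) odd_sum
      (\<lambda>D. \<Sum>k<j. v (runner_hooks t D k) * (\<Prod>l\<in>{..<j} - {k}. u (runner_hooks t D l))) =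
    of_nat j * (\<Prod>k<j. theta t k) * hook_series t u ^ (j - 1) * hook_series t v"
  using assms(2)
proof (induction j)
  case 0
  then show ?case by (simp add: lower_boxes_def weight_series_fin_subsets_empty)
next
  case (Suc j)
  let ?s = "\<lambda>j D. \<Sum>k<j. v (runner_hooks t D k) * (\<Prod>l\<in>{..<j} - {k}. u (runner_hooks t D l))"
  let ?p = "\<lambda>j D. \<Prod>k<j. u (runner_hooks t D k)"
  let ?L = "fin_subsets (lower_boxes t j)" and ?R = "fin_subsets (runner_boxes t j)"
  have fin: "finite_fibres (fin_subsets R) odd_sum" for R
    using finite_fibres_fin_subsets[of 1 R] by simp
  have disj: "lower_boxes t j \<inter> runner_boxes t j = {}"
    using Suc.prems assms(1) by (intro lower_boxes_disjoint) auto
  have step: "?s (Suc j) (D \<union> E) = ?s j D * u (runner_hooks t E j) + ?p j D * v (runner_hooks t E j)"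
    if "D \<in> ?L" "E \<in> ?R" for D E
  proof -
    note split = weight_split_runner[OF Suc.prems assms(1) that]
    \<comment> \<open>A Leibniz rule: the mark is on one of the earlier runners or on runner
      \<open>j\<close>.\<close>
    have "?s (Suc j) F = ?s j F * u (runner_hooks t F j) + ?p j F * v (runner_hooks t F j)" for F
    proof -
      have "(\<Prod>l\<in>{..<Suc j} - {k}. u (runner_hooks t F l)) =
          (\<Prod>l\<in>{..<j} - {k}. u (runner_hooks t F l)) * u (runner_hooks t F j)" if "k < j" for k
      proof -
        have "{..<Suc j} - {k} = insert j ({..<j} - {k})" using that by auto
        then show ?thesis by (simp add: mult.commute)
      qed
      moreover have "{..<Suc j} - {j} = {..<j}" by auto
      ultimately show ?thesis by (simp add: sum_distrib_left sum_distrib_right ac_simps)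
    qed
    moreover have prods: "(\<Prod>l\<in>A. u (runner_hooks t (D \<union> E) l)) = (\<Prod>l\<in>A. u (runner_hooks t D l))"
      if "A \<subseteq> {..<j}" for A
      by (rule prod.cong) (use that split(1) in auto)
    moreover have "?s j (D \<union> E) = ?s j D"
    proof (rule sum.cong)
      fix k assume "k \<in> {..<j}"
      then show "v (runner_hooks t (D \<union> E) k) * (\<Prod>l\<in>{..<j} - {k}. u (runner_hooks t (D \<union> E) l)) =
          v (runner_hooks t D k) * (\<Prod>l\<in>{..<j} - {k}. u (runner_hooks t D l))"
        using prods[of "{..<j} - {k}"] split(1) by simp
    qed simp
    ultimately show ?thesis by (simp only: split(2) order_refl)
  qed
  have "weight_series (fin_subsets (lower_boxes t (Suc j))) odd_sum (?s (Suc j)) =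
    weight_series (?L \<times> ?R) (\<lambda>(D, E). odd_sum D + odd_sum E) (\<lambda>(D, E). ?s (Suc j) (D \<union> E))"
    unfolding lower_boxes_Suc by (rule weight_series_fin_subsets_Un[OF disj])
  also have "\<dots> = weight_series (?L \<times> ?R) (\<lambda>(D, E). odd_sum D + odd_sum E)
      (\<lambda>p. (case p of (D, E) \<Rightarrow> ?s j D * u (runner_hooks t E j)) +
           (case p of (D, E) \<Rightarrow> ?p j D * v (runner_hooks t E j)))"
    by (rule weight_series_cong) (clarsimp simp only: prod.case step)
  also have "\<dots> = weight_series ?L odd_sum (?s j) * weight_series ?R odd_sum (\<lambda>E. u (runner_hooks t E j)) +
      weight_series ?L odd_sum (?p j) * weight_series ?R odd_sum (\<lambda>E. v (runner_hooks t E j))"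
    unfolding weight_series_add by (simp only: weight_series_times[OF fin fin])
  also have "\<dots> = of_nat j * (\<Prod>k<j. theta t k) * hook_series t u ^ (j - 1) * hook_series t v *
        (theta t j * hook_series t u) +
      (\<Prod>k<j. theta t k) * hook_series t u ^ j * (theta t j * hook_series t v)"
  proof -
    have j: "j \<le> (t - 1) div 2" using Suc.prems by simp
    show ?thesis
      by (simp only: Suc.IH[OF j] lower_series_prod[OF assms(1) j, of u]
          runner_series[OF runner_index[OF Suc.prems]])
  qed
  \<comment> \<open>The case \<open>j = 0\<close> is separate because \<open>j - 1\<close> is
    truncated; there the first summand vanishes.\<close>
  also have "\<dots> = of_nat (Suc j) * (\<Prod>k<Suc j. theta t k) * hook_series t u ^ (Suc j - 1) * hook_series t v"
    by (cases j) (simp_all add: algebra_simps)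
  finally show ?case .
qed

text \<open>All finite sets \<open>D\<close> are counted by \<open>odd_sum\<close> in two ways: at
  once, giving \<open>(-q; q^2)\<close>, and by runners, giving the theta series, \<open>m\<close>
  copies of the partition series in \<open>q^(2t)\<close>, and the middle class. The last two are
  known products, so the equation can be solved for the theta series.\<close>

lemma theta_product:
  assumes "odd t"
  defines "m \<equiv> (t - 1) div 2"
  shows "(\<Prod>k<m. theta t k) = qpoch_inf (q_var ^ (2 * t)) (q_var ^ (2 * t)) ^ m *
    qpoch_inf (- q_var) (q_var ^ 2) * unit_inverse (qpoch_inf (- (q_var ^ t)) (q_var ^ (2 * t)))"
proof -
  have t: "0 < t" "m < t" "mirror t m = m" "t = 2 * m + 1"
    using assms(1) by (auto simp: m_def mirror_def elim!: oddE)
  let ?Q = "qpoch_inf (q_var ^ (2 * t)) (q_var ^ (2 * t))"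
  let ?O = "qpoch_inf (- (q_var ^ t)) (q_var ^ (2 * t))"
  let ?P = "hook_series t (\<lambda>_. 1) :: complex poly fps"
  let ?one = "\<lambda>_. 1 :: complex poly"
  have P: "?P * ?Q = 1"
    using partition_series_times_qpoch[of "2 * t"] t by (simp add: hook_series_def)
  have "weight_series (fin_subsets (runner_boxes t m)) odd_sum ?one =
      weight_series (fin_subsets UNIV) (\<lambda>D. t * odd_sum D) ?one"
  \<comment> \<open>Since \<open>t = 2 * m + 1\<close>, the element \<open>t * i + m\<close>
    contributes \<open>t * (2 * i + 1)\<close>; the middle class is a copy of all finite sets with
    sizes scaled by \<open>t\<close>.\<close>
  proof (rule weight_series_bij[symmetric, of "image (\<lambda>i. t * i + m)"])
    have inj: "inj (\<lambda>i. t * i + m)" using t(1) by (intro injI) simp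
    show "bij_betw (image (\<lambda>i. t * i + m)) (fin_subsets UNIV) (fin_subsets (runner_boxes t m))"
      unfolding bij_betw_def
    proof
      show "inj_on (image (\<lambda>i. t * i + m)) (fin_subsets UNIV)"
        by (rule inj_onI) (simp add: inj_image_eq_iff[OF inj])
      show "image (\<lambda>i. t * i + m) ` fin_subsets UNIV = fin_subsets (runner_boxes t m)"
      proof (intro equalityI subsetI)
        fix D assume D: "D \<in> fin_subsets (runner_boxes t m)"
        have "(\<lambda>i. t * i + m) ` ((\<lambda>b. b div t) ` D) = D"
        proof -
          have "t * (b div t) + m = b" if "b \<in> D" for b
          proof -
            have "b mod t = m" using that D t(3) by (auto simp: fin_subsets_def runner_boxes_def)
            then show ?thesis by (metis mult_div_mod_eq)
          qed
          then show ?thesis by (simp add: image_image)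
        qed
        moreover have "(\<lambda>b. b div t) ` D \<in> fin_subsets UNIV" using D by (simp add: fin_subsets_def)
        ultimately show "D \<in> image (\<lambda>i. t * i + m) ` fin_subsets UNIV" by (metis imageI)
      qed (use t(2) in \<open>auto simp: fin_subsets_def runner_boxes_def\<close>)
    qed
    show "odd_sum ((\<lambda>i. t * i + m) ` D) = t * odd_sum D" if "D \<in> fin_subsets UNIV" for D
    proof -
      have "odd_sum ((\<lambda>i. t * i + m) ` D) = (\<Sum>i\<in>D. 2 * (t * i + m) + 1)"
        unfolding odd_sum_def by (subst sum.reindex) (use inj in \<open>auto intro: inj_on_subset\<close>)
      also have "\<dots> = (\<Sum>i\<in>D. t * (2 * i + 1))"
        by (rule sum.cong) (auto simp: t(4) algebra_simps)
      finally show ?thesis by (simp only: odd_sum_def sum_distrib_left)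
    qed
  qed auto
  then have mid: "weight_series (fin_subsets (runner_boxes t m)) odd_sum ?one = ?O"
    using fin_subsets_series[OF t(1)] by simp
  have "qpoch_inf (- q_var) (q_var ^ 2) = weight_series (fin_subsets UNIV) odd_sum ?one"
    using fin_subsets_series[of 1] by simp
  also have "\<dots> = weight_series (fin_subsets (lower_boxes t m \<union> runner_boxes t m)) odd_sum ?one"
    using lower_boxes_Un_middle[OF assms(1)] by (simp add: m_def)
  also have "\<dots> = weight_series (fin_subsets (lower_boxes t m)) odd_sum ?one * ?O"
    unfolding mid[symmetric] using lower_boxes_disjoint[of m t] assms(1)
    by (intro weight_series_fin_subsets_times) (auto simp: m_def)
  also have "weight_series (fin_subsets (lower_boxes t m)) odd_sum ?one = (\<Prod>k<m. theta t k) * ?P ^ m"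
    using lower_series_prod[OF assms(1), of m "\<lambda>_. 1"] by (simp add: m_def)
  finally have O: "qpoch_inf (- q_var) (q_var ^ 2) = (\<Prod>k<m. theta t k) * ?P ^ m * ?O" .
  have "?O * unit_inverse ?O = 1"
    using t by (intro unit_inverse qpoch_inf_has_prod(2)) auto
  moreover have "?P ^ m * ?Q ^ m = 1"
    using P by (simp flip: power_mult_distrib)
  moreover have "Q * (T * P * W) * I = T * (P * Q) * (W * I)" for Q T P W I :: "complex poly fps"
    by (simp only: ac_simps)
  ultimately show ?thesis unfolding O by (simp only: mult_1_right)
qed

section \<open>Assembling the identity for \<open>BG\<close>\<close>

lemma bij_betw_diagonal_BG:
  assumes "odd t"
  shows "bij_betw diagonal (BG t) (fin_subsets (lower_boxes t ((t - 1) div 2)))"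
proof (rule bij_betw_subset[OF bij_betw_diagonal])
  show "BG t \<subseteq> self_conjugates" by (auto simp: BG_def)
  let ?L = "lower_boxes t ((t - 1) div 2)" and ?M = "runner_boxes t ((t - 1) div 2)"
  have "?L \<union> ?M = UNIV" "?L \<inter> ?M = {}"
    using lower_boxes_Un_middle[OF assms] lower_boxes_disjoint[OF order_refl assms] by auto
  then have compl: "D \<inter> ?M = {} \<longleftrightarrow> D \<subseteq> ?L" for D by blast
  have "diagonal ` BG t = diagonal ` {la \<in> self_conjugates. diagonal la \<subseteq> ?L}"
    by (intro arg_cong[of _ _ "image diagonal"] set_eqI)
      (simp only: BG_iff[OF assms] compl mem_Collect_eq)
  also have "\<dots> = {D \<in> diagonal ` self_conjugates. D \<subseteq> ?L}" by blast
  also have "\<dots> = fin_subsets ?L"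
    unfolding bij_betw_imp_surj_on[OF bij_betw_diagonal] by (simp add: fin_subsets_def)
  finally show "diagonal ` BG t = fin_subsets ?L" .
qed

lemma prod_monom: "finite A \<Longrightarrow> (\<Prod>k\<in>A. monom (a k) (e k)) = monom (\<Prod>k\<in>A. a k) (\<Sum>k\<in>A. e k)"
  for a :: "'b \<Rightarrow> 'a::comm_ring_1"
  by (induction A rule: finite_induct) (auto simp: mult_monom)

lemma size_hooks: "size (hooks nu) = sum_list nu"
  by (simp add: hooks_def card_boxes)

theorem theorem6p2:
  fixes t :: nat and rho1 rho2 :: "int \<Rightarrow> int \<Rightarrow> complex"
  assumes "t > 0" and "odd t"
  shows "partition_series (BG t) (\<lambda>la.
      monom ((\<Prod>u\<in>{u \<in> boxes la. hook la u \<in># hooks_t t la}. rho1 (hook la u) (box_sign u)) *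
             (\<Sum>u\<in>{u \<in> boxes la. hook la u \<in># hooks_t t la}. rho2 (hook la u) (box_sign u)))
            (size (hooks_t t la)))
    = of_nat ((t - 1) div 2) *
      unit_power (lift_series (f_series t rho1) oo (x_var ^ 2 * q_var ^ (2 * t))) ((int t - 3) div 2) *
      (lift_series (g_series t rho1 rho2) oo (x_var ^ 2 * q_var ^ (2 * t))) *
      (qpoch_inf (q_var ^ (2 * t)) (q_var ^ (2 * t)) ^ ((t - 1) div 2) *
       qpoch_inf (- q_var) (q_var ^ 2) *
       unit_inverse (qpoch_inf (- (q_var ^ t)) (q_var ^ (2 * t))))"
proof -
  define m where "m = (t - 1) div 2"
  define R1 where "R1 H = (\<Prod>h\<in>#H. rho1 (int t * h) 1 * rho1 (int t * h) (- 1))" for H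
  define R2 where "R2 H = (\<Sum>h\<in>#H. rho2 (int t * h) 1 + rho2 (int t * h) (- 1))" for H
  \<comment> \<open>Weights of an unmarked runner \<open>u\<close> and of the marked one
    \<open>v\<close>; the exponent is doubled because each runner hook comes from two boxes.\<close>
  define u where "u H = monom (R1 H) (2 * size H)" for H :: "int multiset"
  define v where "v H = monom (R1 H * R2 H) (2 * size H)" for H :: "int multiset"
  have f: "lift_series (f_series t rho1) oo (x_var ^ 2 * q_var ^ (2 * t)) = hook_series t u"
    using assms(1) by (simp add: f_series_def lift_series_compose hook_series_def u_def R1_def size_hooks)
  have g: "lift_series (g_series t rho1 rho2) oo (x_var ^ 2 * q_var ^ (2 * t)) = hook_series t v"
    using assms(1)
    by (simp add: g_series_def lift_series_compose hook_series_def v_def R1_def R2_def size_hooks)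
  have weight: "monom ((\<Prod>u\<in>{u \<in> boxes la. hook la u \<in># hooks_t t la}. rho1 (hook la u) (box_sign u)) *
             (\<Sum>u\<in>{u \<in> boxes la. hook la u \<in># hooks_t t la}. rho2 (hook la u) (box_sign u)))
            (size (hooks_t t la)) =
      (\<Sum>k<m. v (runner_hooks t (diagonal la) k) *
        (\<Prod>l\<in>{..<m} - {k}. u (runner_hooks t (diagonal la) l)))" if la: "la \<in> BG t" for la
  proof -
    let ?H = "runner_hooks t (diagonal la)"
    have 1: "(\<Prod>u\<in>{u \<in> boxes la. hook la u \<in># hooks_t t la}. rho1 (hook la u) (box_sign u)) =
        (\<Prod>k<m. R1 (?H k))"
      unfolding prod.signed_div_boxes[OF assms(2) la] R1_def runner_hooks_def m_def
      by (simp only: prod_inversions[of "\<lambda>h. rho1 (int t * h) 1 * rho1 (int t * h) (- 1)"])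
    have 2: "(\<Sum>u\<in>{u \<in> boxes la. hook la u \<in># hooks_t t la}. rho2 (hook la u) (box_sign u)) =
        (\<Sum>k<m. R2 (?H k))"
      unfolding sum.signed_div_boxes[OF assms(2) la] R2_def runner_hooks_def m_def
      by (simp only: sum_inversions[of "\<lambda>h. rho2 (int t * h) 1 + rho2 (int t * h) (- 1)"])
    have 3: "size (hooks_t t la) = (\<Sum>k<m. 2 * size (?H k))"
      by (simp only: size_hooks_t[OF assms(2) la] runner_hooks_def m_def)
    \<comment> \<open>The marked factor contains \<open>R1 (?H k)\<close>, which completes the
      product over all runners; only \<open>R2\<close> still depends on \<open>k\<close>.\<close>
    have "v (?H k) * (\<Prod>l\<in>{..<m} - {k}. u (?H l)) =
        monom ((\<Prod>l<m. R1 (?H l)) * R2 (?H k)) (\<Sum>l<m. 2 * size (?H l))" if "k < m" for k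
    proof -
      have "(\<Prod>l<m. R1 (?H l)) = R1 (?H k) * (\<Prod>l\<in>{..<m} - {k}. R1 (?H l))"
        "(\<Sum>l<m. 2 * size (?H l)) = 2 * size (?H k) + (\<Sum>l\<in>{..<m} - {k}. 2 * size (?H l))"
        using that by (simp_all only: prod.remove[OF finite_lessThan] sum.remove[OF finite_lessThan] lessThan_iff)
      then show ?thesis unfolding u_def v_def by (simp add: prod_monom mult_monom ac_simps)
    qed
    then have "(\<Sum>k<m. v (?H k) * (\<Prod>l\<in>{..<m} - {k}. u (?H l))) =
        (\<Sum>k<m. monom ((\<Prod>l<m. R1 (?H l)) * R2 (?H k)) (\<Sum>l<m. 2 * size (?H l)))"
      by (intro sum.cong) auto
    then show ?thesis unfolding 1 2 3 by (simp add: sum_distrib_left monom_sum)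
  qed
  have "partition_series (BG t) (\<lambda>la.
      monom ((\<Prod>u\<in>{u \<in> boxes la. hook la u \<in># hooks_t t la}. rho1 (hook la u) (box_sign u)) *
             (\<Sum>u\<in>{u \<in> boxes la. hook la u \<in># hooks_t t la}. rho2 (hook la u) (box_sign u)))
            (size (hooks_t t la))) =
    weight_series (BG t) sum_list (\<lambda>la. \<Sum>k<m. v (runner_hooks t (diagonal la) k) *
        (\<Prod>l\<in>{..<m} - {k}. u (runner_hooks t (diagonal la) l)))"
    unfolding partition_series_def weight_series_def
    by (intro arg_cong[of _ _ Abs_fps] ext sum.cong refl) (simp only: weight mem_Collect_eq)
  also have "\<dots> = weight_series (fin_subsets (lower_boxes t m)) odd_sum
      (\<lambda>D. \<Sum>k<m. v (runner_hooks t D k) * (\<Prod>l\<in>{..<m} - {k}. u (runner_hooks t D l)))"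
  proof (rule weight_series_bij)
    show "bij_betw diagonal (BG t) (fin_subsets (lower_boxes t m))"
      unfolding m_def by (rule bij_betw_diagonal_BG[OF assms(2)])
    show "odd_sum (diagonal la) = sum_list la" if "la \<in> BG t" for la
      using that by (simp add: odd_sum_def sum_list_self_conjugate BG_def)
  qed simp
  also have "\<dots> = of_nat m * (\<Prod>k<m. theta t k) * hook_series t u ^ (m - 1) * hook_series t v"
    by (rule lower_series_sum[OF assms(2)]) (simp add: m_def)
  also have "\<dots> = of_nat m * unit_power (hook_series t u) ((int t - 3) div 2) * hook_series t v *
      (\<Prod>k<m. theta t k)"
  \<comment> \<open>For \<open>m = 0\<close>, that is \<open>t = 1\<close>, both sides vanish
    through \<open>of_nat m\<close>, whatever the power with exponent -1 is. Otherwise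
    \<open>(t - 3) / 2 = m - 1\<close> is a natural exponent.\<close>
  proof (cases "m = 0")
    case False
    have "(int t - 3) div 2 = int (m - 1)"
      using assms(2) False by (auto simp: m_def elim!: oddE)
    then show ?thesis by (simp add: unit_power_def ac_simps)
  qed simp
  finally show ?thesis
    unfolding f g m_def theta_product[OF assms(2)] .
qed

end
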